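(* Let $N\ge2$, let $\Phi\in L^2(\mathbb{R})$ be a scale-$N$ father function with associated function $M_0$ on $\mathbb{T}$, and let $\varphi\in L^2(\mathbb{R})$ be a scale-$2$ father function with associated function $m_0$ on $\mathbb{T}$. Assume that $\Phi$ and $\varphi$ are sufficiently regular that $\hat\Phi$ and $\hat\varphi$ are continuous at $0$ and $$\hat\Phi(t)=(2\pi)^{-1/2}\prod_{k=1}^\infty\bigl(N^{-1/2}M_0(tN^{-k})\bigr),\qquad \hat\varphi(t)=(2\pi)^{-1/2}\prod_{k=1}^\infty\bigl(2^{-1/2}m_0(t2^{-k})\bigr).$$ Define isometries on $L^2(\mathbb{T})$ by $(T_0\xi)(z)=M_0(z)\xi(z^N)$ and $(S_0\xi)(z)=m_0(z)\xi(z^2)$. Then the following three conditions are equivalent: (i) $\varphi=\Phi$; (ii) $m_0(Nt)M_0(t)=m_0(t)M_0(2t)$ for almost all $t\in\mathbb{R}$; (iii) $S_0T_0=T_0S_0$.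
   Context: Functions on $\mathbb{T}$ are viewed as $2\pi$-periodic functions of $t$ via $z=e^{-it}$; $\hat f(t)=\frac1{\sqrt{2\pi}}\int_{\mathbb{R}}e^{-ixt}f(x)\,dx$. For an integer $p\ge2$ let $(U_p\xi)(x)=p^{-1/2}\xi(x/p)$ on $L^2(\mathbb{R})$. A scale-$p$ father function is $\varphi\in L^2(\mathbb{R})$ such that $\{\varphi(\cdot-k):k\in\mathbb{Z}\}$ is an orthonormal set; with $\mathcal{V}_0$ its closed linear span, $U_p\varphi\in\mathcal{V}_0$; and $\bigcap_nU_p^n\mathcal{V}_0=\{0\}$, $\overline{\bigcup_nU_p^n\mathcal{V}_0}=L^2(\mathbb{R})$. Its associated function on $\mathbb{T}$ is $m=\sum_ka_ke^{-ikt}$ where $U_p\varphi=\sum_ka_k\varphi(\cdot-k)$; equivalently $\sqrt p\,\hat\varphi(pt)=m(t)\hat\varphi(t)$. *)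

theory Defs
  imports "HOL-Analysis.Analysis"
begin

text \<open>
  Elements of $L^2$ are represented by Borel functions, and equality in $L^2$ is equality
  almost everywhere.
\<close>

definition L2 :: "real measure \<Rightarrow> (real \<Rightarrow> complex) set" where
  "L2 M = {f \<in> borel_measurable M. integrable M (\<lambda>x. (cmod (f x))\<^sup>2)}"

definition L2_sqdist :: "real measure \<Rightarrow> (real \<Rightarrow> complex) \<Rightarrow> (real \<Rightarrow> complex) \<Rightarrow> ennreal" where
  "L2_sqdist M f g = (\<integral>\<^sup>+ x. ennreal ((cmod (f x - g x))\<^sup>2) \<partial>M)"

definition L2_inner :: "(real \<Rightarrow> complex) \<Rightarrow> (real \<Rightarrow> complex) \<Rightarrow> complex" where
  "L2_inner f g = (LINT x|lborel. f x * cnj (g x))"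

definition L2_closure :: "(real \<Rightarrow> complex) set \<Rightarrow> (real \<Rightarrow> complex) set" where
  "L2_closure S = {f \<in> L2 lborel. \<forall>\<epsilon>>0. \<exists>g\<in>S. L2_sqdist lborel f g < \<epsilon>}"

definition circle :: "real measure" where
  "circle = restrict_space lborel {-pi..pi}"

text \<open>
  $L^2(\mathbb{T})$: functions on the circle are $2\pi$-periodic functions of $t$, where
  $z = e^{-it}$.
\<close>

definition L2_circle :: "(real \<Rightarrow> complex) set" where
  "L2_circle = {\<xi> \<in> borel_measurable borel. (\<forall>t. \<xi> (t + 2 * pi) = \<xi> t) \<and> \<xi> \<in> L2 circle}"

text \<open>
  The Fourier transform on $L^2(\mathbb{R})$ is the limit in mean of the transforms of the
  truncations of \<open>f\<close> to bounded intervals (which are integrable); \<open>g\<close> is any representative.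
\<close>

definition is_L2_fourier :: "(real \<Rightarrow> complex) \<Rightarrow> (real \<Rightarrow> complex) \<Rightarrow> bool" where
  "is_L2_fourier f g \<longleftrightarrow> g \<in> L2 lborel \<and>
     ((\<lambda>R::real. L2_sqdist lborel
        (\<lambda>t. complex_of_real (1 / sqrt (2 * pi)) *
              (LINT x:{-R..R}|lborel. exp (- (\<i> * complex_of_real (x * t))) * f x)) g)
       \<longlongrightarrow> 0) at_top"

definition translate :: "int \<Rightarrow> (real \<Rightarrow> complex) \<Rightarrow> (real \<Rightarrow> complex)" where
  "translate k f = (\<lambda>x. f (x - of_int k))"

definition dilate :: "nat \<Rightarrow> (real \<Rightarrow> complex) \<Rightarrow> (real \<Rightarrow> complex)" where
  "dilate p f = (\<lambda>x. complex_of_real (1 / sqrt (real p)) * f (x / real p))"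

definition dilate_pow :: "nat \<Rightarrow> int \<Rightarrow> (real \<Rightarrow> complex) \<Rightarrow> (real \<Rightarrow> complex)" where
  "dilate_pow p n = (if 0 \<le> n then dilate p ^^ nat n else inv (dilate p) ^^ nat (- n))"

definition V0 :: "(real \<Rightarrow> complex) \<Rightarrow> (real \<Rightarrow> complex) set" where
  "V0 \<phi> = L2_closure {\<lambda>x. \<Sum>k\<in>F. c k * translate k \<phi> x | c F. finite F}"

definition father_function :: "nat \<Rightarrow> (real \<Rightarrow> complex) \<Rightarrow> bool" where
  "father_function p \<phi> \<longleftrightarrow>
     \<phi> \<in> L2 lborel \<and>
     (\<forall>k l. L2_inner (translate k \<phi>) (translate l \<phi>) = (if k = l then 1 else 0)) \<and>
     dilate p \<phi> \<in> V0 \<phi> \<and>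
     (\<forall>f \<in> (\<Inter>n. dilate_pow p n ` V0 \<phi>). AE x in lborel. f x = 0) \<and>
     L2_closure (\<Union>n. dilate_pow p n ` V0 \<phi>) = L2 lborel"

text \<open>
  Both expansions are unconditional sums in the respective $L^2$ norm. The function \<open>m\<close> is
  determined by \<open>p\<close> and \<open>\<phi>\<close> up to a null set, since the coefficients are
  $a_k = \langle U_p\varphi, \varphi(\cdot - k)\rangle$.
\<close>

definition associated_function :: "nat \<Rightarrow> (real \<Rightarrow> complex) \<Rightarrow> (real \<Rightarrow> complex) \<Rightarrow> bool" where
  "associated_function p \<phi> m \<longleftrightarrow> m \<in> L2_circle \<and>
     (\<exists>a :: int \<Rightarrow> complex.
        ((\<lambda>F. L2_sqdist lborel (\<lambda>x. \<Sum>k\<in>F. a k * translate k \<phi> x) (dilate p \<phi>))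
           \<longlongrightarrow> 0) (finite_subsets_at_top UNIV) \<and>
        ((\<lambda>F. L2_sqdist circle
                (\<lambda>t. \<Sum>k\<in>F. a k * exp (- (\<i> * complex_of_real (of_int k * t)))) m)
           \<longlongrightarrow> 0) (finite_subsets_at_top UNIV))"

text \<open>The operator $\xi \mapsto m(z)\,\xi(z^p)$; in the variable $t$, $z^p$ corresponds to $pt$.\<close>

definition filter_op :: "nat \<Rightarrow> (real \<Rightarrow> complex) \<Rightarrow> (real \<Rightarrow> complex) \<Rightarrow> (real \<Rightarrow> complex)" where
  "filter_op p m \<xi> = (\<lambda>t. m t * \<xi> (real p * t))"

text \<open>
  \<open>h\<close> satisfies $h(t) = (2\pi)^{-1/2} \prod_{k \ge 1} p^{-1/2} m(t p^{-k})$ for almost every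
  \<open>t\<close>, the infinite product being the limit of its partial products (zero factors and the
  value zero are allowed).
\<close>

definition product_formula :: "nat \<Rightarrow> (real \<Rightarrow> complex) \<Rightarrow> (real \<Rightarrow> complex) \<Rightarrow> bool" where
  "product_formula p m h \<longleftrightarrow>
     (AE t in lborel.
        (\<lambda>n. complex_of_real (1 / sqrt (2 * pi)) *
              (\<Prod>k=1..n. complex_of_real (1 / sqrt (real p)) * m (t / real p ^ k)))
        \<longlonglongrightarrow> h t)"

lemma inv_dilate:
  assumes "p > 0"
  shows "inv (dilate p) f = (\<lambda>x. complex_of_real (sqrt (real p)) * f (real p * x))"
proof (rule inv_f_eq)
  show "inj (dilate p)"
  proof (rule injI, rule ext)
    fix f g x assume "dilate p f = dilate p g"
    then have "dilate p f (real p * x) = dilate p g (real p * x)" by simp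
    then show "f x = g x" using assms by (simp add: dilate_def)
  qed
  show "dilate p (\<lambda>x. complex_of_real (sqrt (real p)) * f (real p * x)) = f"
    using assms by (auto simp: dilate_def simp flip: of_real_mult)
qed

lemma dilate_pow_eq:
  assumes "p > 0"
  shows "dilate_pow p n f = (\<lambda>x. complex_of_real (sqrt (real p) powi (- n)) * f (x * real p powi (- n)))"
proof -
  have *: "(dilate p ^^ m) f = (\<lambda>x. complex_of_real (1 / sqrt (real p) ^ m) * f (x / real p ^ m))" for m
    using assms by (induction m) (simp_all add: dilate_def fun_eq_iff mult_ac)
  have **: "(inv (dilate p) ^^ m) f = (\<lambda>x. complex_of_real (sqrt (real p) ^ m) * f (x * real p ^ m))" for m
    using assms by (induction m) (auto simp: inv_dilate fun_eq_iff mult_ac)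
  show ?thesis
    by (auto simp: dilate_pow_def * ** power_int_def divide_inverse power_inverse fun_eq_iff)
qed

end

theory Submission
  imports Defs
begin

text \<open>
  The product formula gives $\sqrt p\,\hat\varphi(pt) = m(t)\hat\varphi(t)$ a.e.

  (ii) implies (i): by (ii), $g(t) = N^{-1/2} M_0(t/N)\hat\varphi(t/N)$ satisfies the same scale-2
  equation as $\hat\varphi$. The equation for $\hat\Phi$ and continuity at $0$ give
  $M_0 \to \sqrt N$ along almost every orbit $t/(N 2^n)$, so $g$ and $\hat\varphi$ have the same limit
  along $t/2^n$, and the infinite product forces $g = \hat\varphi$. Thus $\hat\varphi$ solves the
  scale-$N$ equation too, hence $\hat\varphi = \hat\Phi$, and the Fourier transform is injective.

  (i) implies (ii): the defect $m_0(Nt)M_0(t) - m_0(t)M_0(2t)$ is periodic and is annihilated by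
  $\hat\varphi$. Orthonormality of the translates means that multiplication of trigonometric
  polynomials by $\hat\varphi$ is bounded below, so $\hat\varphi$ cannot vanish on a periodic set of
  positive measure.

  Both steps only need $\|f\| \le \|\hat f\|$ for compactly supported $f$. For support in
  $[-\pi,\pi]$ the samples $\hat f(s+n)$, $n \in \mathbb{Z}$, are the Fourier coefficients of
  $e^{-isx} f(x)$, so this is Parseval's inequality integrated over $s \in [0,1)$.
\<close>

section \<open>Approximation in mean square\<close>

text \<open>Condition (iii) compares two multiples of the same function
  \<open>\<xi> (2 * N * t)\<close>, so (ii) and (iii) differ only by testing on the constant 1; the
  work lies in (i) and (ii). The obstacle is that the transform exists only as a limit in mean.
  Truncations have an honest integral transform, and the convergence of these is what
  \<open>is_L2_fourier\<close> provides. What remains is the way back from transforms to functions,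
  and for this a bound in one direction suffices. Constants such as 4 or \<open>8 * pi\<close> lost
  on the way are harmless, because every conclusion drawn is that some function vanishes almost
  everywhere. Density of trigonometric polynomials is proved for an arbitrary finite Borel measure
  on the line because it serves twice: with Lebesgue measure on one period, for Parseval, and with
  that measure plus \<open>|\<phi>hat|^2 dt\<close>, for the nonvanishing argument. The common value
  of both transforms at 0 is a further point: the product formulas hold only almost everywhere and
  do not give it directly.\<close>

definition sqnorm :: "'a measure \<Rightarrow> ('a \<Rightarrow> complex) \<Rightarrow> ennreal" where
  "sqnorm M f = (\<integral>\<^sup>+ x. ennreal ((cmod (f x))\<^sup>2) \<partial>M)"

lemma cmod_add_sq_le: "(cmod (a + b))\<^sup>2 \<le> 2 * (cmod a)\<^sup>2 + 2 * (cmod b)\<^sup>2"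
proof -
  have "(cmod (a + b))\<^sup>2 \<le> (cmod a + cmod b)\<^sup>2"
    by (intro power_mono norm_triangle_ineq) auto
  also have "\<dots> \<le> 2 * (cmod a)\<^sup>2 + 2 * (cmod b)\<^sup>2"
    using sum_squares_bound[of "cmod a" "cmod b"] by (simp add: power2_sum)
  finally show ?thesis .
qed

text \<open>Squared norms with values in \<open>ennreal\<close> avoid integrability conditions and
  square roots; the price is the factor 2 in place of the usual triangle inequality.\<close>

lemma sqnorm_add_le:
  assumes [measurable]: "f \<in> borel_measurable M" "g \<in> borel_measurable M"
  shows "sqnorm M (\<lambda>x. f x + g x) \<le> 2 * sqnorm M f + 2 * sqnorm M g"
proof -
  have "sqnorm M (\<lambda>x. f x + g x) \<le>
      (\<integral>\<^sup>+ x. 2 * ennreal ((cmod (f x))\<^sup>2) + 2 * ennreal ((cmod (g x))\<^sup>2) \<partial>M)"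
    unfolding sqnorm_def
  proof (rule nn_integral_mono)
    fix x
    have "ennreal ((cmod (f x + g x))\<^sup>2) \<le> ennreal (2 * (cmod (f x))\<^sup>2 + 2 * (cmod (g x))\<^sup>2)"
      by (intro ennreal_leI cmod_add_sq_le)
    also have "\<dots> = 2 * ennreal ((cmod (f x))\<^sup>2) + 2 * ennreal ((cmod (g x))\<^sup>2)"
      by (simp add: ennreal_mult)
    finally show "ennreal ((cmod (f x + g x))\<^sup>2) \<le> \<dots>" .
  qed
  also have "\<dots> = 2 * sqnorm M f + 2 * sqnorm M g"
    unfolding sqnorm_def by (simp add: nn_integral_add nn_integral_cmult)
  finally show ?thesis .
qed

lemma sqnorm_triangle:
  assumes [measurable]: "f \<in> borel_measurable M" "g \<in> borel_measurable M" "h \<in> borel_measurable M"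
  shows "sqnorm M (\<lambda>x. f x - h x) \<le> 2 * sqnorm M (\<lambda>x. f x - g x) + 2 * sqnorm M (\<lambda>x. g x - h x)"
  using sqnorm_add_le[of "\<lambda>x. f x - g x" M "\<lambda>x. g x - h x"] by simp

lemma sqnorm_cmult:
  assumes [measurable]: "f \<in> borel_measurable M"
  shows "sqnorm M (\<lambda>x. c * f x) = ennreal ((cmod c)\<^sup>2) * sqnorm M f"
  unfolding sqnorm_def
  by (simp add: norm_mult power_mult_distrib ennreal_mult nn_integral_cmult)

lemma sqnorm_minus_commute: "sqnorm M (\<lambda>x. f x - g x) = sqnorm M (\<lambda>x. g x - f x)"
  by (simp add: sqnorm_def norm_minus_commute)

lemma sqnorm_eq_0_iff:
  assumes [measurable]: "f \<in> borel_measurable M"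
  shows "sqnorm M f = 0 \<longleftrightarrow> (AE x in M. f x = 0)"
  unfolding sqnorm_def by (simp add: nn_integral_0_iff_AE)

lemma sqnorm_cong_AE:
  assumes "AE x in M. f x = g x"
  shows "sqnorm M f = sqnorm M g"
  unfolding sqnorm_def by (intro nn_integral_cong_AE) (use assms in auto)

text \<open>Error budget for \<open>sqnorm_add_le\<close>: two errors below e/4, each doubled, stay
  below e.\<close>

lemma ennreal_quarter_less:
  fixes a b :: ennreal
  assumes "a < ennreal (e / 4)" "b < ennreal (e / 4)"
  shows "2 * a + 2 * b < ennreal e"
proof -
  obtain a' b' where ab: "a = ennreal a'" "b = ennreal b'" "0 \<le> a'" "0 \<le> b'"
    using assms by (cases a; cases b) auto
  have "a' < e / 4" "b' < e / 4"
    using assms ab by (auto simp: ennreal_less_iff)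
  then have "ennreal (2 * a' + 2 * b') < ennreal e"
    using ab by (intro ennreal_lessI) auto
  moreover have "ennreal (2 * a' + 2 * b') = 2 * a + 2 * b"
    using ab by (simp add: ennreal_mult)
  ultimately show ?thesis by simp
qed

definition approximable :: "'a measure \<Rightarrow> ('a \<Rightarrow> complex) set \<Rightarrow> ('a \<Rightarrow> complex) \<Rightarrow> bool" where
  "approximable M S f \<longleftrightarrow> (\<forall>e>0. \<exists>u\<in>S. sqnorm M (\<lambda>x. f x - u x) < ennreal e)"

lemma approximable_trans:
  assumes S: "S \<subseteq> borel_measurable M" and f: "f \<in> borel_measurable M"
    and approx: "\<And>e. e > 0 \<Longrightarrow>
      \<exists>g\<in>borel_measurable M. approximable M S g \<and> sqnorm M (\<lambda>x. f x - g x) < ennreal e"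
  shows "approximable M S f"
  unfolding approximable_def
proof (intro allI impI)
  fix e :: real assume e: "e > 0"
  obtain g where g: "g \<in> borel_measurable M" "approximable M S g"
      "sqnorm M (\<lambda>x. f x - g x) < ennreal (e / 4)"
    using approx[of "e / 4"] e by auto
  obtain u where u: "u \<in> S" "sqnorm M (\<lambda>x. g x - u x) < ennreal (e / 4)"
    using g(2) e unfolding approximable_def by (metis zero_less_divide_iff zero_less_numeral)
  have "sqnorm M (\<lambda>x. f x - u x) < ennreal e"
    using sqnorm_triangle[OF f g(1), of u] S u(1) ennreal_quarter_less[OF g(3) u(2)]
    by (auto intro: le_less_trans)
  then show "\<exists>u\<in>S. sqnorm M (\<lambda>x. f x - u x) < ennreal e"
    using u(1) by blast
qed

lemma approximable_add:
  assumes S: "S \<subseteq> borel_measurable M" "\<And>u v. u \<in> S \<Longrightarrow> v \<in> S \<Longrightarrow> (\<lambda>x. u x + v x) \<in> S"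
    and [measurable]: "f \<in> borel_measurable M" "g \<in> borel_measurable M"
    and fg: "approximable M S f" "approximable M S g"
  shows "approximable M S (\<lambda>x. f x + g x)"
  unfolding approximable_def
proof (intro allI impI)
  fix e :: real assume e: "e > 0"
  obtain u where u: "u \<in> S" "sqnorm M (\<lambda>x. f x - u x) < ennreal (e / 4)"
    using fg(1) e unfolding approximable_def by (metis zero_less_divide_iff zero_less_numeral)
  obtain v where v: "v \<in> S" "sqnorm M (\<lambda>x. g x - v x) < ennreal (e / 4)"
    using fg(2) e unfolding approximable_def by (metis zero_less_divide_iff zero_less_numeral)
  have [measurable]: "u \<in> borel_measurable M" "v \<in> borel_measurable M"
    using S(1) u v by auto
  have "sqnorm M (\<lambda>x. (f x - u x) + (g x - v x)) < ennreal e"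
    by (rule le_less_trans[OF sqnorm_add_le ennreal_quarter_less[OF u(2) v(2)]]) measurable
  then show "\<exists>w\<in>S. sqnorm M (\<lambda>x. f x + g x - w x) < ennreal e"
    using S(2)[OF u(1) v(1)] by (intro bexI[of _ "\<lambda>x. u x + v x"]) (simp_all add: algebra_simps)
qed

lemma approximable_cmult:
  assumes S: "S \<subseteq> borel_measurable M" "\<And>u. u \<in> S \<Longrightarrow> (\<lambda>x. c * u x) \<in> S"
    and [measurable]: "f \<in> borel_measurable M" and f: "approximable M S f"
  shows "approximable M S (\<lambda>x. c * f x)"
  unfolding approximable_def
proof (intro allI impI)
  fix e :: real assume e: "e > 0"
  \<comment> \<open>The summand 1 keeps d positive when c is 0, so that e / d is a legitimate error
    bound.\<close>
  define d where "d = (cmod c)\<^sup>2 + 1"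
  have d: "d > 0" by (simp add: d_def add_nonneg_pos)
  obtain u where u: "u \<in> S" "sqnorm M (\<lambda>x. f x - u x) < ennreal (e / d)"
    using f e d unfolding approximable_def by (metis zero_less_divide_iff)
  have [measurable]: "u \<in> borel_measurable M"
    using S(1) u by auto
  have "sqnorm M (\<lambda>x. c * (f x - u x)) = ennreal ((cmod c)\<^sup>2) * sqnorm M (\<lambda>x. f x - u x)"
    by (rule sqnorm_cmult) measurable
  also have "\<dots> \<le> ennreal d * sqnorm M (\<lambda>x. f x - u x)"
    by (intro mult_right_mono ennreal_leI) (auto simp: d_def)
  also have "\<dots> < ennreal d * ennreal (e / d)"
    using u(2) d by (intro ennreal_mult_strict_left_mono) auto
  also have "\<dots> = ennreal e"
    using d e by (simp flip: ennreal_mult)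
  finally have "sqnorm M (\<lambda>x. c * f x - c * u x) < ennreal e"
    by (simp add: algebra_simps)
  then show "\<exists>w\<in>S. sqnorm M (\<lambda>x. c * f x - w x) < ennreal e"
    using S(2)[OF u(1)] by (intro bexI[of _ "\<lambda>x. c * u x"])
qed

text \<open>By regularity A lies between a compact K and an open U with U - K of measure below e. A
  Urysohn function for K and the complement of U agrees with the indicator off U - K and differs
  from it by at most 1 there.\<close>

lemma indicator_approximable_continuous:
  fixes M :: "complex measure"
  assumes "finite_measure M" "sets M = sets borel" "A \<in> sets borel"
  shows "approximable M {u. continuous_on UNIV u} (indicator A)"
  unfolding approximable_def
proof (intro allI impI)
  fix e :: real assume e: "e > 0"
  interpret finite_measure M by fact
  have fin: "emeasure M (space M) \<noteq> \<infinity>" by simp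
  have "\<exists>K\<in>{K. K \<subseteq> A \<and> compact K}. emeasure M A < emeasure M K + ennreal (e / 2)"
    using e by (intro SUP_approx_ennreal inner_regular[OF assms(2) fin assms(3)]) (auto intro: exI[of _ "{}"])
  then obtain K where K: "K \<subseteq> A" "compact K" "emeasure M A < emeasure M K + ennreal (e / 2)"
    by blast
  have "\<exists>U\<in>{U. A \<subseteq> U \<and> open U}. emeasure M U < emeasure M A + ennreal (e / 2)"
    using e by (intro INF_approx_ennreal outer_regular[OF assms(2) fin assms(3)]) (auto intro: exI[of _ UNIV])
  then obtain U where U: "A \<subseteq> U" "open U" "emeasure M U < emeasure M A + ennreal (e / 2)"
    by blast
  have KU: "K \<subseteq> U" "K \<in> sets M" "U \<in> sets M"
    using K U assms(2) by (auto simp: borel_compact)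
  have "measure M U < measure M A + e / 2" "measure M A < measure M K + e / 2"
    using K(3) U(3) e by (simp_all add: emeasure_eq_measure ennreal_less_iff flip: ennreal_plus)
  then have UK: "emeasure M (U - K) < ennreal e"
    using KU e by (simp add: emeasure_eq_measure finite_measure_Diff ennreal_lessI)
  obtain u :: "complex \<Rightarrow> complex" where u: "continuous_on UNIV u"
      "\<And>x. u x \<in> closed_segment 0 1" "\<And>x. x \<in> - U \<Longrightarrow> u x = 0" "\<And>x. x \<in> K \<Longrightarrow> u x = 1"
    using Urysohn[of "- U" K 0 1] U(2) K(2) KU(1) by (auto simp: compact_imp_closed)
  have "sqnorm M (\<lambda>x. indicator A x - u x) \<le> (\<integral>\<^sup>+ x. indicator (U - K) x \<partial>M)"
    unfolding sqnorm_def
  proof (rule nn_integral_mono)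
    fix x
    obtain s where s: "u x = complex_of_real s" "0 \<le> s" "s \<le> 1"
      using u(2)[of x] by (auto simp: closed_segment_def scaleR_conv_of_real)
    have "\<bar>1 - s\<bar>\<^sup>2 \<le> 1\<^sup>2" "\<bar>s\<bar>\<^sup>2 \<le> 1\<^sup>2"
      using s by (intro power_mono; auto)+
    moreover have "cmod (1 - complex_of_real s) = \<bar>1 - s\<bar>"
      by (metis norm_of_real of_real_1 of_real_diff)
    ultimately have "(cmod (1 - u x))\<^sup>2 \<le> 1" "(cmod (u x))\<^sup>2 \<le> 1"
      using s by auto
    then show "ennreal ((cmod (indicator A x - u x))\<^sup>2) \<le> indicator (U - K) x"
      using u(3,4)[of x] K(1) U(1) by (cases "x \<in> K"; cases "x \<in> U"; cases "x \<in> A") auto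
  qed
  also have "\<dots> < ennreal e"
    using UK KU by simp
  finally show "\<exists>u\<in>{u. continuous_on UNIV u}. sqnorm M (\<lambda>x. indicator A x - u x) < ennreal e"
    using u(1) by blast
qed

lemma L2_approximable_continuous:
  fixes M :: "complex measure" and f :: "complex \<Rightarrow> complex"
  assumes M: "finite_measure M" "sets M = sets borel"
    and f: "f \<in> borel_measurable M" and f2: "sqnorm M f < \<infinity>"
  shows "approximable M {u. continuous_on UNIV u} f"
proof -
  let ?S = "{u::complex \<Rightarrow> complex. continuous_on UNIV u}"
  have S: "?S \<subseteq> borel_measurable M"
    using M(2) by (auto intro: borel_measurable_continuous_onI cong: measurable_cong_sets)
  have zero: "approximable M ?S (\<lambda>x. 0)"
    unfolding approximable_def by (auto intro!: exI[of _ "\<lambda>x. 0"] simp: sqnorm_def)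
  have simple: "approximable M ?S s" if s: "simple_function M s" for s
  proof -
    have fin: "finite (s ` space M)"
      using s by (simp add: simple_function_def)
    have meas: "s -` {y} \<inter> space M \<in> sets M" for y
      using s by (intro measurable_sets[OF borel_measurable_simple_function]) auto
    have "approximable M ?S (\<lambda>x. \<Sum>y\<in>Y. y * indicator (s -` {y} \<inter> space M) x)" if "finite Y" for Y
      using that
    proof induction
      case empty
      show ?case using zero by simp
    next
      case (insert y Y)
      have "approximable M ?S (\<lambda>x. y * indicator (s -` {y} \<inter> space M) x)"
        using meas M by (intro approximable_cmult S indicator_approximable_continuous)
          (auto intro!: continuous_intros)
      then have "approximable M ?S (\<lambda>x. y * indicator (s -` {y} \<inter> space M) x +
          (\<Sum>y\<in>Y. y * indicator (s -` {y} \<inter> space M) x))"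
        using insert.IH meas by (intro approximable_add S) (auto intro!: continuous_intros)
      then show ?case unfolding sum.insert[OF insert.hyps] .
    qed
    from this[OF fin] have "approximable M ?S (\<lambda>x. \<Sum>y\<in>s ` space M. y * indicator (s -` {y} \<inter> space M) x)" .
    moreover have "(\<Sum>y\<in>s ` space M. y * indicator (s -` {y} \<inter> space M) x) = s x" for x
    proof -
      have "x \<in> space M" using sets_eq_imp_space_eq[OF M(2)] by simp
      then show ?thesis
        using fin by (simp add: indicator_def of_bool_def if_distrib[of "(*) _"] sum.delta' cong: if_cong)
    qed
    ultimately show ?thesis by simp
  qed
  obtain s where "\<forall>i. simple_function M (s i)" "\<forall>x\<in>space M. (\<lambda>i. s i x) \<longlonglongrightarrow> f x"
      "\<forall>i. \<forall>x\<in>space M. dist (s i x) 0 \<le> 2 * dist (f x) 0"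
    using borel_measurable_implies_sequence_metric[OF f, of 0] by blast
  then have s: "\<And>i. simple_function M (s i)" "\<And>x. x \<in> space M \<Longrightarrow> (\<lambda>i. s i x) \<longlonglongrightarrow> f x"
      "\<And>i x. x \<in> space M \<Longrightarrow> cmod (s i x) \<le> 2 * cmod (f x)"
    by auto
  have [measurable]: "\<And>i. s i \<in> borel_measurable M" "f \<in> borel_measurable M"
    using s(1) f by (auto intro: borel_measurable_simple_function)
  have lim: "(\<lambda>i. sqnorm M (\<lambda>x. f x - s i x)) \<longlonglongrightarrow> 0"
  proof -
    have "(\<lambda>i. \<integral>\<^sup>+ x. ennreal (norm (0 - complex_of_real ((cmod (f x - s i x))\<^sup>2))) \<partial>M) \<longlonglongrightarrow> 0"
    proof (rule nn_integral_dominated_convergence_norm[where w = "\<lambda>x. 9 * (cmod (f x))\<^sup>2"])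
      show "AE x in M. cmod (complex_of_real ((cmod (f x - s j x))\<^sup>2)) \<le> 9 * (cmod (f x))\<^sup>2" for j
      proof (rule AE_I2)
        fix x assume x: "x \<in> space M"
        \<comment> \<open>The approximants satisfy |s_j| \<le> 2|f|, so the error is at most 3|f|;
          its square gives the dominating function 9|f|^2.\<close>
        have "cmod (f x - s j x) \<le> 3 * cmod (f x)"
          using norm_triangle_ineq4[of "f x" "s j x"] s(3)[OF x, of j] by simp
        then have "(cmod (f x - s j x))\<^sup>2 \<le> (3 * cmod (f x))\<^sup>2"
          by (intro power_mono) auto
        then show "cmod (complex_of_real ((cmod (f x - s j x))\<^sup>2)) \<le> 9 * (cmod (f x))\<^sup>2"
          unfolding norm_of_real by (simp add: power_mult_distrib)
      qed
      show "(\<integral>\<^sup>+ x. ennreal (9 * (cmod (f x))\<^sup>2) \<partial>M) < \<infinity>"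
        using f2 by (simp add: sqnorm_def ennreal_mult nn_integral_cmult ennreal_mult_less_top)
      show "AE x in M. (\<lambda>i. complex_of_real ((cmod (f x - s i x))\<^sup>2)) \<longlonglongrightarrow> 0"
      proof (rule AE_I2)
        fix x assume x: "x \<in> space M"
        have "(\<lambda>i. complex_of_real ((cmod (f x - s i x))\<^sup>2)) \<longlonglongrightarrow> complex_of_real ((cmod (f x - f x))\<^sup>2)"
          by (intro tendsto_intros s(2) x)
        then show "(\<lambda>i. complex_of_real ((cmod (f x - s i x))\<^sup>2)) \<longlonglongrightarrow> 0" by simp
      qed
    qed measurable
    then show ?thesis by (simp add: sqnorm_def norm_power)
  qed
  show ?thesis
  proof (rule approximable_trans[OF S f])
    fix e :: real assume "e > 0"
    then have "eventually (\<lambda>i. sqnorm M (\<lambda>x. f x - s i x) < ennreal e) sequentially"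
      using lim by (intro order_tendstoD(2)) auto
    then obtain i where "sqnorm M (\<lambda>x. f x - s i x) < ennreal e"
      by (auto simp: eventually_sequentially)
    then show "\<exists>g\<in>borel_measurable M. approximable M ?S g \<and> sqnorm M (\<lambda>x. f x - g x) < ennreal e"
      using simple[OF s(1)] by (intro bexI[of _ "s i"]) auto
  qed
qed

section \<open>Density of trigonometric polynomials\<close>

definition trig :: "int \<Rightarrow> real \<Rightarrow> complex" where
  "trig k t = exp (- (\<i> * complex_of_real (of_int k * t)))"

lemma trig_eq_cis: "trig k t = cis (- (of_int k * t))"
  by (simp add: trig_def cis_conv_exp)

lemma trig_add: "trig (k + l) t = trig k t * trig l t"
  by (simp add: trig_eq_cis cis_mult algebra_simps)

lemma cnj_trig: "cnj (trig k t) = trig (- k) t"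
  by (simp add: trig_eq_cis cis_cnj)

lemma norm_trig [simp]: "cmod (trig k t) = 1"
  by (simp add: trig_eq_cis)

lemma continuous_on_trig: "continuous_on A (trig k)"
  unfolding trig_def by (intro continuous_intros)

lemma borel_measurable_trig [measurable]: "trig k \<in> borel_measurable borel"
  by (intro borel_measurable_continuous_onI continuous_on_trig)

text \<open>Generated by closure rules, so that closure under products and the Stone-Weierstrass
  induction need no handling of coefficients; \<open>trig_polys_eq_sum\<close> recovers them when
  orthogonality is used.\<close>

inductive_set trig_polys :: "(real \<Rightarrow> complex) set" where
  monom: "(\<lambda>t. c * trig k t) \<in> trig_polys"
| add: "p \<in> trig_polys \<Longrightarrow> q \<in> trig_polys \<Longrightarrow> (\<lambda>t. p t + q t) \<in> trig_polys"

lemma trig_polys_const: "(\<lambda>t. c) \<in> trig_polys"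
  using trig_polys.monom[of c 0] by (simp add: trig_def)

lemma trig_polys_mult:
  assumes "p \<in> trig_polys" "q \<in> trig_polys"
  shows "(\<lambda>t. p t * q t) \<in> trig_polys"
  using assms(1)
proof induction
  case (monom c k)
  show ?case using assms(2)
  proof induction
    case (monom d l)
    then show ?case using trig_polys.monom[of "c * d" "k + l"] by (simp add: trig_add mult_ac)
  next
    case (add p q)
    then show ?case using trig_polys.add[OF add.IH] by (simp add: distrib_left)
  qed
next
  case (add p r)
  then show ?case using trig_polys.add[OF add.IH] by (simp add: distrib_right)
qed

lemma trig_polys_eq_sum:
  assumes "p \<in> trig_polys"
  obtains K c where "finite K" "p = (\<lambda>t. \<Sum>k\<in>K. c k * trig k t)"
proof -
  have "\<exists>K c. finite K \<and> p = (\<lambda>t. \<Sum>k\<in>K. c k * trig k t)"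
    using assms
  proof induction
    case (monom c k)
    then show ?case by (intro exI[of _ "{k}"] exI[of _ "\<lambda>_. c"]) simp
  next
    case (add p q)
    obtain K c where K: "finite K" "p = (\<lambda>t. \<Sum>k\<in>K. c k * trig k t)"
      using add.IH by blast
    obtain L d where L: "finite L" "q = (\<lambda>t. \<Sum>k\<in>L. d k * trig k t)"
      using add.IH by blast
    define c' where "c' k = (if k \<in> K then c k else 0)" for k
    define d' where "d' k = (if k \<in> L then d k else 0)" for k
    have "(\<Sum>k\<in>K. c k * trig k t) = (\<Sum>k\<in>K \<union> L. c' k * trig k t)" for t
      using K(1) L(1) by (intro sum.mono_neutral_cong_left) (auto simp: c'_def)
    moreover have "(\<Sum>k\<in>L. d k * trig k t) = (\<Sum>k\<in>K \<union> L. d' k * trig k t)" for t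
      using K(1) L(1) by (intro sum.mono_neutral_cong_left) (auto simp: d'_def)
    ultimately show ?case
      using K L by (intro exI[of _ "K \<union> L"] exI[of _ "\<lambda>k. c' k + d' k"])
        (auto simp: distrib_right sum.distrib)
  qed
  then show ?thesis using that by blast
qed

lemma borel_measurable_trig_polys: "p \<in> trig_polys \<Longrightarrow> p \<in> borel_measurable borel"
  by (erule trig_polys.induct) measurable

lemma real_polynomial_cis_trig:
  fixes p :: "complex \<Rightarrow> real"
  assumes "real_polynomial_function p"
  shows "(\<lambda>t. complex_of_real (p (cis t))) \<in> trig_polys"
  using assms
proof induction
  case (linear f)
  interpret bounded_linear f by fact
  \<comment> \<open>A real-linear functional on the circle is cos t f(1) + sin t f(i); Euler's
    formulas rewrite this with \<open>trig (-1)\<close>, which is e^{it}, and \<open>trig 1\<close>,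
    which is e^{-it}.\<close>
  have eq: "complex_of_real (f (cis t)) =
      ((f 1 - \<i> * f \<i>) / 2) * trig (-1) t + ((f 1 + \<i> * f \<i>) / 2) * trig 1 t" for t
  proof -
    have "cis t = cos t *\<^sub>R 1 + sin t *\<^sub>R \<i>"
      by (simp add: complex_eq_iff)
    then have "f (cis t) = cos t * f 1 + sin t * f \<i>"
      by (simp only: add scaleR) simp
    then show ?thesis
      by (simp add: trig_eq_cis complex_eq_iff field_simps)
  qed
  show ?case
    unfolding eq by (intro trig_polys.intros)
next
  case (const c)
  then show ?case by (rule trig_polys_const)
next
  case (add f g)
  then show ?case using trig_polys.add[OF add.IH] by simp
next
  case (mult f g)
  then show ?case using trig_polys_mult[OF mult.IH] by simp
qed

lemma polynomial_cis_trig: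
  fixes p :: "complex \<Rightarrow> complex"
  assumes "polynomial_function p"
  shows "(\<lambda>t. p (cis t)) \<in> trig_polys"
proof -
  have "real_polynomial_function (Re \<circ> p)" "real_polynomial_function (Im \<circ> p)"
    using assms bounded_linear_Re bounded_linear_Im by (auto simp: polynomial_function_def)
  note this[THEN real_polynomial_cis_trig]
  then have "(\<lambda>t. complex_of_real (Re (p (cis t))) + \<i> * complex_of_real (Im (p (cis t)))) \<in> trig_polys"
    by (intro trig_polys.add trig_polys_mult trig_polys_const) (simp_all add: o_def)
  then show ?thesis by (simp flip: complex_eq)
qed

lemma sqnorm_distr:
  assumes "g \<in> measurable M N" "f \<in> borel_measurable N"
  shows "sqnorm (distr M N g) f = sqnorm M (\<lambda>x. f (g x))"
  unfolding sqnorm_def using assms by (subst nn_integral_distr) auto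

text \<open>Writing the function as F(cis t) encodes periodicity. Push M forward to the plane along
  \<open>cis\<close>, approximate F by a continuous u in the image measure, approximate u uniformly
  on the unit circle by a polynomial in Re z and Im z, and pull back. The measure M itself may
  charge the whole line.\<close>

lemma trig_polys_dense:
  fixes M :: "real measure" and F :: "complex \<Rightarrow> complex"
  assumes M: "finite_measure M" and sets_M [measurable_cong]: "sets M = sets borel"
    and F [measurable]: "F \<in> borel_measurable borel" and F2: "sqnorm M (\<lambda>t. F (cis t)) < \<infinity>"
  shows "approximable M trig_polys (\<lambda>t. F (cis t))"
proof -
  interpret finite_measure M by fact
  have cis [measurable]: "cis \<in> measurable borel borel"
    by (intro borel_measurable_continuous_onI continuous_intros)
  then have cis': "cis \<in> measurable M borel"
    by measurable
  have S: "trig_polys \<subseteq> borel_measurable M"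
    using borel_measurable_trig_polys by (auto cong: measurable_cong_sets[OF sets_M refl])
  define \<nu> where "\<nu> = distr M borel cis"
  have "finite_measure \<nu>"
    unfolding \<nu>_def using cis' by (rule finite_measure_distr)
  moreover have "sqnorm \<nu> F < \<infinity>"
    using F2 cis' F by (simp add: \<nu>_def sqnorm_distr)
  ultimately have dense: "approximable \<nu> {u. continuous_on UNIV u} F"
    by (intro L2_approximable_continuous) (auto simp: \<nu>_def)
  show ?thesis
  proof (rule approximable_trans[OF S])
    show "(\<lambda>t. F (cis t)) \<in> borel_measurable M" by measurable
  next
    fix e :: real assume "e > 0"
    then obtain u where u: "continuous_on UNIV u" "sqnorm \<nu> (\<lambda>x. F x - u x) < ennreal e"
      using dense unfolding approximable_def by blast
    have [measurable]: "u \<in> borel_measurable borel"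
      using u(1) by (rule borel_measurable_continuous_onI)
    have "approximable M trig_polys (\<lambda>t. u (cis t))"
      unfolding approximable_def
    proof (intro allI impI)
      fix d :: real assume d: "d > 0"
      \<comment> \<open>A uniform error below \<eta> costs at most \<eta> squared times the total
        mass, which this choice keeps below d; adding 1 covers mass 0.\<close>
      define \<eta> where "\<eta> = sqrt (d / (2 * (measure M (space M) + 1)))"
      have pos: "measure M (space M) + 1 > 0"
        by (simp add: add_nonneg_pos)
      then have \<eta>: "\<eta> > 0" "\<eta>\<^sup>2 = d / (2 * (measure M (space M) + 1))"
        using d by (auto simp: \<eta>_def)
      have "\<exists>p. polynomial_function p \<and> (\<forall>x\<in>sphere 0 1. norm (u x - p x) < \<eta>)"
        by (rule Stone_Weierstrass_polynomial_function[OF compact_sphere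
          continuous_on_subset[OF u(1) subset_UNIV] \<eta>(1)])
      then obtain p where p: "polynomial_function p" "\<forall>x\<in>sphere 0 1. norm (u x - p x) < \<eta>"
        by blast
      have "sqnorm M (\<lambda>t. u (cis t) - p (cis t)) \<le> (\<integral>\<^sup>+ t. ennreal (\<eta>\<^sup>2) \<partial>M)"
        unfolding sqnorm_def
      proof (rule nn_integral_mono)
        fix t
        have "norm (u (cis t) - p (cis t)) < \<eta>" using p(2) by simp
        then show "ennreal ((cmod (u (cis t) - p (cis t)))\<^sup>2) \<le> ennreal (\<eta>\<^sup>2)"
          by (intro ennreal_leI power_mono) auto
      qed
      also have "\<dots> = ennreal (\<eta>\<^sup>2 * measure M (space M))"
        by (simp add: emeasure_eq_measure ennreal_mult)
      also have "\<dots> < ennreal d"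
      proof (rule ennreal_lessI[OF d])
        have "m < 2 * (m + 1)" if "m \<ge> 0" for m :: real
          using that by simp
        from this[OF measure_nonneg] d
        have "d * measure M (space M) < d * (2 * (measure M (space M) + 1))"
          by (intro mult_strict_left_mono)
        then show "\<eta>\<^sup>2 * measure M (space M) < d"
          using pos unfolding \<eta>(2) by (simp add: field_simps)
      qed
      finally show "\<exists>q\<in>trig_polys. sqnorm M (\<lambda>t. u (cis t) - q t) < ennreal d"
        using polynomial_cis_trig[OF p(1)] by (intro bexI[of _ "\<lambda>t. p (cis t)"])
    qed
    moreover have "sqnorm M (\<lambda>t. F (cis t) - u (cis t)) < ennreal e"
      using u(2) cis' by (simp add: \<nu>_def sqnorm_distr)
    ultimately show "\<exists>g\<in>borel_measurable M. approximable M trig_polys g \<and>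
        sqnorm M (\<lambda>t. F (cis t) - g t) < ennreal e"
      by (intro bexI[of _ "\<lambda>t. u (cis t)"]) auto
  qed
qed

text \<open>\<open>Arg\<close> is continuous off the closed nonpositive real axis and takes only the
  values 0 and pi on it. It is used to turn functions of t into functions of the point
  \<open>cis t\<close>.\<close>

lemma borel_measurable_Arg [measurable]: "Arg \<in> borel_measurable borel"
proof -
  have [measurable]: "(\<real>\<^sub>\<le>\<^sub>0 :: complex set) \<in> sets borel"
    by (intro borel_closed closed_nonpos_Reals_complex)
  have "(\<lambda>z. indicator (- \<real>\<^sub>\<le>\<^sub>0) z *\<^sub>R Arg z) \<in> borel_measurable borel"
    by (intro borel_measurable_continuous_on_indicator continuous_on_Arg) measurable
  then have "(\<lambda>z. if z \<in> \<real>\<^sub>\<le>\<^sub>0 then if z = 0 then 0 else pi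
      else indicator (- \<real>\<^sub>\<le>\<^sub>0) z *\<^sub>R Arg z) \<in> borel_measurable borel"
    by measurable
  also have "(\<lambda>z. if z \<in> \<real>\<^sub>\<le>\<^sub>0 then if z = 0 then 0 else pi
      else indicator (- \<real>\<^sub>\<le>\<^sub>0) z *\<^sub>R Arg z) = Arg"
  proof
    fix z :: complex
    have "Arg z = pi" if "z \<in> \<real>\<^sub>\<le>\<^sub>0" "z \<noteq> 0"
      using that by (subst Arg_eq_pi) (auto simp: complex_nonpos_Reals_iff complex_eq_iff)
    then show "(if z \<in> \<real>\<^sub>\<le>\<^sub>0 then if z = 0 then 0 else pi
      else indicator (- \<real>\<^sub>\<le>\<^sub>0) z *\<^sub>R Arg z) = Arg z"
      by (auto simp: Arg_zero)
  qed
  finally show ?thesis .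
qed

section \<open>A lower Parseval inequality\<close>

lemma L2_iff: "f \<in> L2 M \<longleftrightarrow> f \<in> borel_measurable M \<and> sqnorm M f < \<infinity>"
  by (auto simp: L2_def sqnorm_def integrable_iff_bounded)

lemma L2_measurable: "f \<in> L2 M \<Longrightarrow> f \<in> borel_measurable M"
  by (simp add: L2_def)

lemma L2_integrable: "f \<in> L2 M \<Longrightarrow> integrable M (\<lambda>x. (cmod (f x))\<^sup>2)"
  by (simp add: L2_def)

lemma sqnorm_eq_integral: "f \<in> L2 M \<Longrightarrow> sqnorm M f = ennreal (LINT x|M. (cmod (f x))\<^sup>2)"
  unfolding sqnorm_def L2_def by (intro nn_integral_eq_integral) auto

lemma L2_cmult: "f \<in> L2 M \<Longrightarrow> (\<lambda>x. c * f x) \<in> L2 M"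
  by (auto simp: L2_iff sqnorm_cmult ennreal_mult_less_top)

lemma L2_add:
  assumes "f \<in> L2 M" "g \<in> L2 M"
  shows "(\<lambda>x. f x + g x) \<in> L2 M"
proof -
  have [measurable]: "f \<in> borel_measurable M" "g \<in> borel_measurable M"
    using assms by (auto simp: L2_iff)
  have "2 * sqnorm M f + 2 * sqnorm M g < \<infinity>"
    using assms by (auto simp: L2_iff ennreal_mult_less_top)
  then show ?thesis
    using le_less_trans[OF sqnorm_add_le[of f M g]] by (auto simp: L2_iff)
qed

lemma L2_diff: "f \<in> L2 M \<Longrightarrow> g \<in> L2 M \<Longrightarrow> (\<lambda>x. f x - g x) \<in> L2 M"
  using L2_add[of f M "\<lambda>x. (- 1) * g x"] L2_cmult[of g M "- 1"] by simp

lemma L2_sum: "(\<And>k. k \<in> K \<Longrightarrow> f k \<in> L2 M) \<Longrightarrow> (\<lambda>x. \<Sum>k\<in>K. f k x) \<in> L2 M"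
proof (induction K rule: infinite_finite_induct)
  case (insert k K)
  then show ?case by (simp add: L2_add)
qed (auto simp: L2_def)

lemma L2_mono:
  assumes "f \<in> L2 M" "g \<in> borel_measurable M" "\<And>x. cmod (g x) \<le> cmod (f x)"
  shows "g \<in> L2 M"
proof -
  have "sqnorm M g \<le> sqnorm M f"
    unfolding sqnorm_def by (intro nn_integral_mono ennreal_leI power_mono assms(3)) auto
  then show ?thesis
    using assms by (auto simp: L2_iff)
qed

lemma borel_measurable_cnj [measurable]: "cnj \<in> borel_measurable borel"
  by (intro borel_measurable_continuous_onI continuous_intros)

lemma L2_integrable_mult_cnj:
  assumes "f \<in> L2 M" "g \<in> L2 M"
  shows "integrable M (\<lambda>x. f x * cnj (g x))"
proof (rule Bochner_Integration.integrable_bound)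
  have [measurable]: "f \<in> borel_measurable M" "g \<in> borel_measurable M"
    using assms by (auto simp: L2_iff)
  show "integrable M (\<lambda>x. (cmod (f x))\<^sup>2 + (cmod (g x))\<^sup>2)"
    using assms by (auto simp: L2_def)
  show "(\<lambda>x. f x * cnj (g x)) \<in> borel_measurable M" by measurable
  have "cmod a * cmod b \<le> (cmod a)\<^sup>2 + (cmod b)\<^sup>2" for a b :: complex
    using sum_squares_bound[of "cmod a" "cmod b"] mult_nonneg_nonneg[OF norm_ge_zero norm_ge_zero, of a b]
    by linarith
  then show "AE x in M. norm (f x * cnj (g x)) \<le> norm ((cmod (f x))\<^sup>2 + (cmod (g x))\<^sup>2)"
    by (auto simp: norm_mult)
qed

lemma integral_norm_sq_diff:
  assumes "f \<in> L2 M" "g \<in> L2 M"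
  shows "(LINT x|M. (cmod (f x - g x))\<^sup>2) = (LINT x|M. (cmod (f x))\<^sup>2)
    - 2 * Re (LINT x|M. f x * cnj (g x)) + (LINT x|M. (cmod (g x))\<^sup>2)"
proof -
  have "(cmod (a - b))\<^sup>2 = (cmod a)\<^sup>2 - 2 * Re (a * cnj b) + (cmod b)\<^sup>2" for a b
    by (simp add: cmod_power2 power2_diff algebra_simps)
  then have "(LINT x|M. (cmod (f x - g x))\<^sup>2) =
      (LINT x|M. (cmod (f x))\<^sup>2 - 2 * Re (f x * cnj (g x)) + (cmod (g x))\<^sup>2)"
    by simp
  also have "\<dots> = (LINT x|M. (cmod (f x))\<^sup>2)
    - 2 * Re (LINT x|M. f x * cnj (g x)) + (LINT x|M. (cmod (g x))\<^sup>2)"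
    using L2_integrable[OF assms(1)] L2_integrable[OF assms(2)]
      L2_integrable_mult_cnj[OF assms, THEN integrable_Re] integral_Re[OF L2_integrable_mult_cnj[OF assms]]
    by (simp only: Bochner_Integration.integral_add Bochner_Integration.integral_diff
        Bochner_Integration.integrable_diff integrable_mult_right integral_mult_right_zero)
  finally show ?thesis .
qed

lemma integral_mult_cnj_sum:
  assumes "f \<in> L2 M" "\<And>k. e k \<in> L2 M"
  shows "(LINT x|M. f x * cnj (\<Sum>k\<in>K. c k * e k x)) = (\<Sum>k\<in>K. cnj (c k) * (LINT x|M. f x * cnj (e k x)))"
proof -
  have "f x * cnj (\<Sum>k\<in>K. c k * e k x) = (\<Sum>k\<in>K. cnj (c k) * (f x * cnj (e k x)))" for x
    by (simp add: sum_distrib_left mult_ac)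
  then show ?thesis
    using L2_integrable_mult_cnj[OF assms] by simp
qed

text \<open>The common square norm \<kappa> is a parameter because two systems occur: characters on
  the arc with 2 pi, and translates of a father function with 1.\<close>

lemma orthogonal_sum_norm_sq:
  assumes e: "\<And>k. e k \<in> L2 M"
    and orth: "\<And>k l. (LINT x|M. e k x * cnj (e l x)) = (if k = l then complex_of_real \<kappa> else 0)"
    and K: "finite K"
  shows "(LINT x|M. (cmod (\<Sum>k\<in>K. c k * e k x))\<^sup>2) = \<kappa> * (\<Sum>k\<in>K. (cmod (c k))\<^sup>2)"
proof -
  define s where "s x = (\<Sum>k\<in>K. c k * e k x)" for x
  have s: "s \<in> L2 M"
    unfolding s_def[abs_def] by (intro L2_sum L2_cmult e)
  have se: "(LINT x|M. e l x * cnj (s x)) = (if l \<in> K then complex_of_real \<kappa> * cnj (c l) else 0)" for l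
    unfolding s_def using integral_mult_cnj_sum[OF e e, where K = K and c = c] K
    by (simp add: orth if_distrib sum.delta mult.commute cong: if_cong)
  have "complex_of_real (LINT x|M. (cmod (s x))\<^sup>2) = (LINT x|M. s x * cnj (s x))"
    by (simp add: complex_norm_square[symmetric] flip: integral_complex_of_real)
  also have "\<dots> = (\<Sum>l\<in>K. cnj (c l) * (LINT x|M. s x * cnj (e l x)))"
    using integral_mult_cnj_sum[OF s e, where K = K and c = c] by (simp add: s_def)
  also have "\<dots> = (\<Sum>l\<in>K. cnj (c l) * cnj (LINT x|M. e l x * cnj (s x)))"
    by (simp add: mult.commute flip: Bochner_Integration.integral_cnj)
  also have "\<dots> = (\<Sum>l\<in>K. complex_of_real (\<kappa> * (cmod (c l))\<^sup>2))"
  proof (rule sum.cong)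
    fix l assume "l \<in> K"
    have "complex_of_real ((cmod (c l))\<^sup>2) = c l * cnj (c l)"
      by (rule complex_norm_square)
    then show "cnj (c l) * cnj (LINT x|M. e l x * cnj (s x)) = complex_of_real (\<kappa> * (cmod (c l))\<^sup>2)"
      using \<open>l \<in> K\<close> unfolding se of_real_mult by simp
  qed simp
  finally have "complex_of_real (LINT x|M. (cmod (s x))\<^sup>2) = complex_of_real (\<kappa> * (\<Sum>k\<in>K. (cmod (c k))\<^sup>2))"
    by (simp add: sum_distrib_left)
  then show ?thesis
    unfolding s_def of_real_eq_iff .
qed

text \<open>Expand the square of the residual and complete the square in each coefficient. Since c
  is arbitrary, any good approximation of g bounds its norm by its Fourier coefficients; the optimal
  c need not be identified.\<close>

lemma orthogonal_residual:
  assumes g: "g \<in> L2 M" and e: "\<And>k. e k \<in> L2 M"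
    and orth: "\<And>k l. (LINT x|M. e k x * cnj (e l x)) = (if k = l then complex_of_real \<kappa> else 0)"
    and K: "finite K" and \<kappa>: "\<kappa> > 0"
  shows "(LINT x|M. (cmod (g x))\<^sup>2) \<le> (LINT x|M. (cmod (g x - (\<Sum>k\<in>K. c k * e k x)))\<^sup>2)
    + (\<Sum>k\<in>K. (cmod (LINT x|M. g x * cnj (e k x)))\<^sup>2) / \<kappa>"
proof -
  define \<gamma> where "\<gamma> k = (LINT x|M. g x * cnj (e k x))" for k
  have s: "(\<lambda>x. \<Sum>k\<in>K. c k * e k x) \<in> L2 M"
    by (intro L2_sum L2_cmult e)
  have "2 * Re (cnj (c k) * \<gamma> k) \<le> \<kappa> * (cmod (c k))\<^sup>2 + (cmod (\<gamma> k))\<^sup>2 / \<kappa>" for k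
  proof -
    have "Re (cnj (c k) * \<gamma> k) \<le> cmod (c k) * cmod (\<gamma> k)"
      using complex_Re_le_cmod[of "cnj (c k) * \<gamma> k"] by (simp add: norm_mult)
    moreover have "0 \<le> (\<kappa> * cmod (c k) - cmod (\<gamma> k))\<^sup>2 / \<kappa>"
      using \<kappa> by simp
    moreover have "(\<kappa> * cmod (c k) - cmod (\<gamma> k))\<^sup>2 / \<kappa>
        = \<kappa> * (cmod (c k))\<^sup>2 + (cmod (\<gamma> k))\<^sup>2 / \<kappa> - 2 * (cmod (c k) * cmod (\<gamma> k))"
      using \<kappa> by (simp add: power2_diff power2_eq_square field_simps)
    ultimately show ?thesis by linarith
  qed
  then have "(\<Sum>k\<in>K. 2 * Re (cnj (c k) * \<gamma> k)) \<le> (\<Sum>k\<in>K. \<kappa> * (cmod (c k))\<^sup>2 + (cmod (\<gamma> k))\<^sup>2 / \<kappa>)"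
    by (rule sum_mono)
  then have "2 * Re (\<Sum>k\<in>K. cnj (c k) * \<gamma> k) \<le> \<kappa> * (\<Sum>k\<in>K. (cmod (c k))\<^sup>2) + (\<Sum>k\<in>K. (cmod (\<gamma> k))\<^sup>2) / \<kappa>"
    by (simp only: sum.distrib Re_sum sum_distrib_left sum_divide_distrib)
  then show ?thesis
    unfolding integral_norm_sq_diff[OF g s] integral_mult_cnj_sum[OF g e]
      orthogonal_sum_norm_sq[OF e orth K] \<gamma>_def[symmetric] by simp
qed

text \<open>Unlike \<open>circle\<close>, this has all Borel sets of the line as its measurable sets.\<close>

definition arc :: "real measure" where
  "arc = density lborel (\<lambda>x. ennreal (indicator {-pi..pi} x))"

lemma sets_arc [simp, measurable_cong]: "sets arc = sets borel"
  by (simp add: arc_def)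

lemma finite_measure_arc: "finite_measure arc"
proof (rule finite_measureI)
  have "emeasure arc (space arc) = (\<integral>\<^sup>+ x. indicator {-pi..pi} x \<partial>lborel)"
    by (simp add: arc_def emeasure_density ennreal_indicator)
  also have "\<dots> = ennreal (2 * pi)"
    by simp
  finally show "emeasure arc (space arc) \<noteq> \<infinity>"
    by simp
qed

lemma integral_arc:
  fixes f :: "real \<Rightarrow> 'a :: {banach, second_countable_topology}"
  assumes "f \<in> borel_measurable borel"
  shows "(LINT x|arc. f x) = (LINT x|lborel. indicator {-pi..pi} x *\<^sub>R f x)"
  unfolding arc_def using assms by (intro integral_density) auto

lemma L2_arc_bounded:
  assumes [measurable]: "f \<in> borel_measurable borel" and "\<And>x. cmod (f x) \<le> B"
  shows "f \<in> L2 arc"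
proof -
  interpret finite_measure arc by (rule finite_measure_arc)
  have "(\<lambda>x. complex_of_real \<bar>B\<bar>) \<in> L2 arc"
    by (simp add: L2_def)
  then show ?thesis
    by (rule L2_mono) (use assms in \<open>auto intro: order_trans abs_ge_self\<close>)
qed

lemma trig_L2_arc: "trig k \<in> L2 arc"
  by (rule L2_arc_bounded[of _ 1]) auto

lemma trig_orthogonal:
  "(LINT t|arc. trig k t * cnj (trig l t)) = (if k = l then complex_of_real (2 * pi) else 0)"
proof -
  have eq: "(LINT t|arc. trig k t * cnj (trig l t)) = (LINT t|lborel. indicator {-pi..pi} t *\<^sub>R trig (k - l) t)"
    by (subst integral_arc) (auto simp: cnj_trig simp flip: trig_add)
  show ?thesis
  proof (cases "k = l")
    case True
    then show ?thesis unfolding eq by (simp add: trig_def scaleR_conv_of_real)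
  next
    case False
    define n :: complex where "n = of_int (k - l)"
    have n: "n \<noteq> 0" using False by (simp add: n_def)
    define F where "F t = trig (k - l) t / (- \<i> * n)" for t
    have "(LINT t|lborel. indicator {-pi..pi} t *\<^sub>R trig (k - l) t) = F pi - F (-pi)"
    proof (rule integral_FTC_Icc)
      fix t assume "-pi \<le> t" "t \<le> pi"
      have "((\<lambda>z. exp (- \<i> * n * z) / (- \<i> * n)) has_field_derivative exp (- \<i> * n * complex_of_real t))
          (at (complex_of_real t))"
        using n by (auto intro!: derivative_eq_intros)
      then have "((\<lambda>t. exp (- \<i> * n * complex_of_real t) / (- \<i> * n)) has_vector_derivative exp (- \<i> * n * complex_of_real t))
          (at t within {-pi..pi})"
        by (intro has_vector_derivative_real_field)
      then show "(F has_vector_derivative trig (k - l) t) (at t within {-pi..pi})"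
        by (simp add: F_def[abs_def] trig_def n_def mult_ac)
    qed (auto intro: continuous_on_trig)
    also have "F pi - F (-pi) = 0"
    proof -
      have "trig (k - l) (- pi) = trig (k - l) pi"
        by (simp add: trig_eq_cis complex_eq_iff del: of_int_diff)
          (metis mult.commute sin_npi_int sin_minus minus_zero)
      then show ?thesis by (simp add: F_def)
    qed
    finally show ?thesis using False eq by simp
  qed
qed

text \<open>Take a trigonometric polynomial within e of g; \<open>orthogonal_residual\<close>
  charges the error e and replaces the coefficients of the polynomial by those of g.\<close>

lemma parseval_lower:
  assumes g: "g \<in> L2 arc" and e: "e > 0"
  obtains K where "finite K"
    "(LINT x|arc. (cmod (g x))\<^sup>2) \<le> e + (\<Sum>k\<in>K. (cmod (LINT x|arc. g x * cnj (trig k x)))\<^sup>2) / (2 * pi)"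
proof -
  have gm [measurable]: "g \<in> borel_measurable borel"
    using L2_measurable[OF g] by (simp cong: measurable_cong_sets[OF sets_arc refl])
  \<comment> \<open>Density concerns functions of \<open>cis t\<close>, and g need not be periodic.
    Since \<open>Arg\<close> takes values in (-pi, pi], the periodic version differs from g on the
    arc at most at the endpoint -pi.\<close>
  have AE: "AE t in arc. g (Arg (cis t)) = g t"
  proof -
    have "AE t in lborel. t \<noteq> - pi" by (rule AE_lborel_singleton)
    then have "AE t in lborel. 0 < ennreal (indicator {-pi..pi} t) \<longrightarrow> g (Arg (cis t)) = g t"
    proof eventually_elim
      case (elim t)
      show ?case
        using Arg_cis[of t] elim by (auto simp: indicator_def)
    qed
    then show ?thesis unfolding arc_def by (subst AE_density) auto
  qed
  have "sqnorm arc (\<lambda>t. g (Arg (cis t))) = sqnorm arc g"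
    by (rule sqnorm_cong_AE[OF AE])
  then have "approximable arc trig_polys (\<lambda>t. g (Arg (cis t)))"
    using g by (intro trig_polys_dense[where F = "\<lambda>z. g (Arg z)"] finite_measure_arc) (auto simp: L2_iff)
  then obtain p where p: "p \<in> trig_polys" "sqnorm arc (\<lambda>t. g (Arg (cis t)) - p t) < ennreal e"
    using e unfolding approximable_def by blast
  have "sqnorm arc (\<lambda>t. g (Arg (cis t)) - p t) = sqnorm arc (\<lambda>t. g t - p t)"
    using AE by (intro sqnorm_cong_AE) auto
  with p(2) have less: "sqnorm arc (\<lambda>t. g t - p t) < ennreal e" by simp
  obtain K c where K: "finite K" "p = (\<lambda>t. \<Sum>k\<in>K. c k * trig k t)"
    using trig_polys_eq_sum[OF p(1)] .
  have "(\<lambda>t. g t - p t) \<in> L2 arc"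
    unfolding K(2) by (intro L2_diff g L2_sum L2_cmult trig_L2_arc)
  then have "(LINT t|arc. (cmod (g t - p t))\<^sup>2) \<le> e"
    using less e by (simp add: sqnorm_eq_integral ennreal_less_iff)
  then show ?thesis
    using orthogonal_residual[OF g trig_L2_arc trig_orthogonal K(1), of c] that[OF K(1)]
    by (simp add: K(2))
qed

section \<open>A lower Plancherel inequality\<close>

text \<open>Meant for integrable f only, in practice functions of bounded support: on others the
  Bochner integral has the default value 0 and would not be the transform.\<close>

definition FT :: "(real \<Rightarrow> complex) \<Rightarrow> real \<Rightarrow> complex" where
  "FT f t = complex_of_real (1 / sqrt (2 * pi)) *
     (LINT x|lborel. exp (- (\<i> * complex_of_real (x * t))) * f x)"

lemma borel_measurable_FT [measurable]:
  assumes [measurable]: "f \<in> borel_measurable borel"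
  shows "FT f \<in> borel_measurable borel"
proof -
  have "(\<lambda>t. LINT x|lborel. exp (- (\<i> * complex_of_real (x * t))) * f x) \<in> borel_measurable borel"
    by measurable
  then show ?thesis unfolding FT_def[abs_def] by measurable
qed

text \<open>On [-R, R] one has |f| \<le> |f|^2 + 1, and both terms are integrable there.\<close>

lemma L2_supported_integrable:
  assumes f: "f \<in> L2 lborel" and supp: "\<And>x. \<bar>x\<bar> > R \<Longrightarrow> f x = 0"
  shows "integrable lborel f"
proof (rule Bochner_Integration.integrable_bound)
  have [measurable]: "f \<in> borel_measurable borel"
    using L2_measurable[OF f] by simp
  show "integrable lborel (\<lambda>x. (cmod (f x))\<^sup>2 + indicator {-R..R} x)"
    using L2_integrable[OF f] by (intro Bochner_Integration.integrable_add) (auto simp: integrable_indicator_iff emeasure_lborel_Icc_eq)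
  show "f \<in> borel_measurable lborel" by simp
  have *: "a \<le> a\<^sup>2 + 1" for a :: real
  proof -
    have "2 * a \<le> a\<^sup>2 + 1" using sum_squares_bound[of a 1] by simp
    moreover have "0 \<le> a\<^sup>2" by simp
    ultimately show ?thesis by linarith
  qed
  have "cmod (f x) \<le> (cmod (f x))\<^sup>2 + indicator {-R..R} x" for x
    using *[of "cmod (f x)"] supp[of x] by (cases "\<bar>x\<bar> > R") (auto simp: indicator_def)
  then show "AE x in lborel. norm (f x) \<le> norm ((cmod (f x))\<^sup>2 + indicator {-R..R} x)"
    by (auto simp: abs_of_nonneg)
qed

lemma FT_diff:
  assumes "integrable lborel f" "integrable lborel g"
  shows "FT (\<lambda>x. f x - g x) t = FT f t - FT g t"
proof -
  have "integrable lborel (\<lambda>x. exp (- (\<i> * complex_of_real (x * t))) * h x)"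
    if "integrable lborel h" for h
    using that by (rule Bochner_Integration.integrable_bound) (use that in \<open>auto simp: norm_mult\<close>)
  from this[OF assms(1)] this[OF assms(2)] show ?thesis
    by (simp add: FT_def right_diff_distrib)
qed

lemma FT_sum_translate:
  assumes "integrable lborel f"
  shows "FT (\<lambda>x. \<Sum>k\<in>K. c k * translate k f x) t = (\<Sum>k\<in>K. c k * trig k t) * FT f t"
proof -
  have int: "integrable lborel (\<lambda>x. exp (- (\<i> * complex_of_real (x * t))) * f x)"
    using assms by (rule Bochner_Integration.integrable_bound) (use assms in \<open>auto simp: norm_mult\<close>)
  \<comment> \<open>The shift is spelled as \<open>- of_int k + 1 * x\<close> to match the affine
    substitution rule with slope 1.\<close>
  have eq: "exp (- (\<i> * complex_of_real (x * t))) * translate k f x =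
      trig k t * (exp (- (\<i> * complex_of_real ((- of_int k + 1 * x) * t))) * f (- of_int k + 1 * x))" for k x
    by (simp add: translate_def trig_def algebra_simps flip: exp_add)
  have tr: "(LINT x|lborel. exp (- (\<i> * complex_of_real (x * t))) * translate k f x) =
      trig k t * (LINT x|lborel. exp (- (\<i> * complex_of_real (x * t))) * f x)" for k
    unfolding eq integral_mult_right_zero
    by (subst (2) lborel_integral_real_affine[where c = 1 and t = "- of_int k"]) auto
  have int': "integrable lborel (\<lambda>x. exp (- (\<i> * complex_of_real (x * t))) * translate k f x)" for k
    unfolding eq using lborel_integrable_real_affine[OF int, of 1 "- of_int k"] by simp
  have "(LINT x|lborel. exp (- (\<i> * complex_of_real (x * t))) * (\<Sum>k\<in>K. c k * translate k f x)) =
      (LINT x|lborel. (\<Sum>k\<in>K. c k * (exp (- (\<i> * complex_of_real (x * t))) * translate k f x)))"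
    by (simp add: sum_distrib_left mult_ac)
  also have "\<dots> = (\<Sum>k\<in>K. c k * (trig k t * (LINT x|lborel. exp (- (\<i> * complex_of_real (x * t))) * f x)))"
    using int' by (simp add: tr del: of_real_mult)
  finally show ?thesis
    by (simp add: FT_def sum_distrib_right sum_divide_distrib mult_ac)
qed

lemma sqnorm_le_FT_samples:
  assumes f: "f \<in> L2 lborel" and supp: "\<And>x. \<bar>x\<bar> > pi \<Longrightarrow> f x = 0"
  shows "sqnorm lborel f \<le> (\<Sum>n. ennreal ((cmod (FT f (s - of_int (int_decode n))))\<^sup>2))"
proof (rule ennreal_le_epsilon)
  fix e :: real assume e: "e > 0"
  have fm [measurable]: "f \<in> borel_measurable borel"
    using L2_measurable[OF f] by simp
  define g where "g x = exp (- (\<i> * complex_of_real (x * s))) * f x" for x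
  have gm [measurable]: "g \<in> borel_measurable borel"
    unfolding g_def[abs_def] by measurable
  have norm_g: "cmod (g x) = cmod (f x)" for x
    by (simp add: g_def norm_mult)
  have ind: "indicator {-pi..pi} x *\<^sub>R h = h" if "f x = 0 \<Longrightarrow> h = 0" for x and h :: complex
    using supp[of x] that by (auto simp: indicator_def)
  have sq: "sqnorm arc g = sqnorm lborel f"
  proof -
    have "sqnorm arc g = (\<integral>\<^sup>+ x. ennreal (indicator {-pi..pi} x) * ennreal ((cmod (g x))\<^sup>2) \<partial>lborel)"
      unfolding sqnorm_def arc_def by (subst nn_integral_density) auto
    also have "\<dots> = sqnorm lborel f"
      unfolding sqnorm_def using supp by (intro nn_integral_cong) (auto simp: norm_g indicator_def)
    finally show ?thesis .
  qed
  have g: "g \<in> L2 arc"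
    using f by (simp add: L2_iff sq gm measurable_cong_sets[OF sets_arc refl])
  obtain K where K: "finite K" "(LINT x|arc. (cmod (g x))\<^sup>2) \<le>
      e + (\<Sum>k\<in>K. (cmod (LINT x|arc. g x * cnj (trig k x)))\<^sup>2) / (2 * pi)"
    using parseval_lower[OF g e] .
  have coeff: "(LINT x|arc. g x * cnj (trig k x)) = complex_of_real (sqrt (2 * pi)) * FT f (s - of_int k)" for k
  proof -
    have "(LINT x|arc. g x * cnj (trig k x)) = (LINT x|lborel. g x * cnj (trig k x))"
      by (subst integral_arc) (auto simp: ind g_def)
    also have "\<dots> = (LINT x|lborel. exp (- (\<i> * complex_of_real (x * (s - of_int k)))) * f x)"
      by (intro Bochner_Integration.integral_cong refl)
        (simp only: g_def cnj_trig, simp add: trig_def algebra_simps flip: exp_add)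
    also have "\<dots> = complex_of_real (sqrt (2 * pi)) * FT f (s - of_int k)"
      by (simp add: FT_def)
    finally show ?thesis .
  qed
  have "(\<Sum>k\<in>K. (cmod (LINT x|arc. g x * cnj (trig k x)))\<^sup>2) / (2 * pi) =
      (\<Sum>k\<in>K. (cmod (FT f (s - of_int k)))\<^sup>2)"
    unfolding coeff by (simp add: norm_mult power_mult_distrib flip: sum_distrib_left)
  with K(2) have le: "(LINT x|arc. (cmod (g x))\<^sup>2) \<le> e + (\<Sum>k\<in>K. (cmod (FT f (s - of_int k)))\<^sup>2)"
    by simp
  have "sqnorm lborel f = ennreal (LINT x|arc. (cmod (g x))\<^sup>2)"
    unfolding sq[symmetric] by (rule sqnorm_eq_integral[OF g])
  also have "\<dots> \<le> ennreal e + (\<Sum>k\<in>K. ennreal ((cmod (FT f (s - of_int k)))\<^sup>2))"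
    using ennreal_leI[OF le] e by (simp add: ennreal_plus sum_nonneg sum_ennreal)
  finally have upper: "sqnorm lborel f \<le> ennreal e + (\<Sum>k\<in>K. ennreal ((cmod (FT f (s - of_int k)))\<^sup>2))" .
  have "(\<Sum>k\<in>K. ennreal ((cmod (FT f (s - of_int k)))\<^sup>2)) =
      (\<Sum>n\<in>int_encode ` K. ennreal ((cmod (FT f (s - of_int (int_decode n))))\<^sup>2))"
    by (subst sum.reindex[OF inj_int_encode]) auto
  also have "\<dots> \<le> (\<Sum>n. ennreal ((cmod (FT f (s - of_int (int_decode n))))\<^sup>2))"
    using K(1) by (intro sum_le_suminf) auto
  finally show "sqnorm lborel f \<le> (\<Sum>n. ennreal ((cmod (FT f (s - of_int (int_decode n))))\<^sup>2)) + ennreal e"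
    unfolding add.commute[of _ "ennreal e"] by (rule order_trans[OF upper add_left_mono])
qed

text \<open>The integer translates of [0, 1) tile the line: after interchanging sum and integral and
  shifting, each u is counted once, for the index encoding the negative of its floor.\<close>

lemma nn_integral_periodize:
  fixes f :: "real \<Rightarrow> ennreal"
  assumes [measurable]: "f \<in> borel_measurable borel"
  shows "(\<integral>\<^sup>+ s\<in>{0..<1}. (\<Sum>n. f (s - of_int (int_decode n))) \<partial>lborel) = (\<integral>\<^sup>+ u. f u \<partial>lborel)"
proof -
  have one: "(\<Sum>n. indicator {0..<1} (u + of_int (int_decode n))) = (1::ennreal)" for u :: real
  proof -
    have "u + of_int (int_decode n) \<in> {0..<1} \<longleftrightarrow> n = int_encode (- \<lfloor>u\<rfloor>)" for n
    proof -
      have "u + of_int (int_decode n) \<in> {0..<1} \<longleftrightarrow> \<lfloor>u\<rfloor> = - int_decode n"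
        by (simp add: floor_eq_iff) linarith
      also have "\<dots> \<longleftrightarrow> n = int_encode (- \<lfloor>u\<rfloor>)"
        by (metis int_decode_inverse int_encode_inverse minus_minus)
      finally show ?thesis .
    qed
    then have "(\<lambda>n. indicator {0..<1} (u + of_int (int_decode n)) :: ennreal) =
        (\<lambda>n. if n = int_encode (- \<lfloor>u\<rfloor>) then 1 else 0)"
      unfolding indicator_def by (intro ext) (simp del: atLeastLessThan_iff)
    then show ?thesis
      using sums_unique[OF sums_single[of "int_encode (- \<lfloor>u\<rfloor>)" "\<lambda>_. 1::ennreal"]] by simp
  qed
  have "(\<integral>\<^sup>+ s\<in>{0..<1}. (\<Sum>n. f (s - of_int (int_decode n))) \<partial>lborel) =
      (\<integral>\<^sup>+ s. (\<Sum>n. f (s - of_int (int_decode n)) * indicator {0..<1} s) \<partial>lborel)"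
    by simp
  also have "\<dots> = (\<Sum>n. \<integral>\<^sup>+ s. f (s - of_int (int_decode n)) * indicator {0..<1} s \<partial>lborel)"
    by (intro nn_integral_suminf) measurable
  also have "\<dots> = (\<Sum>n. \<integral>\<^sup>+ u. f u * indicator {0..<1} (u + of_int (int_decode n)) \<partial>lborel)"
  proof (intro suminf_cong)
    fix n
    show "(\<integral>\<^sup>+ s. f (s - of_int (int_decode n)) * indicator {0..<1} s \<partial>lborel) =
        (\<integral>\<^sup>+ u. f u * indicator {0..<1} (u + of_int (int_decode n)) \<partial>lborel)"
      by (subst nn_integral_real_affine[where c = 1 and t = "of_int (int_decode n)"])
        (auto simp: add.commute)
  qed
  also have "\<dots> = (\<integral>\<^sup>+ u. (\<Sum>n. f u * indicator {0..<1} (u + of_int (int_decode n))) \<partial>lborel)"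
    by (intro nn_integral_suminf[symmetric]) measurable
  also have "\<dots> = (\<integral>\<^sup>+ u. f u \<partial>lborel)"
    by (simp add: one)
  finally show ?thesis .
qed

lemma sqnorm_le_FT_pi:
  assumes f: "f \<in> L2 lborel" and supp: "\<And>x. \<bar>x\<bar> > pi \<Longrightarrow> f x = 0"
  shows "sqnorm lborel f \<le> sqnorm lborel (FT f)"
proof -
  have [measurable]: "f \<in> borel_measurable borel"
    using L2_measurable[OF f] by simp
  have "sqnorm lborel f = (\<integral>\<^sup>+ s\<in>{0..<1::real}. sqnorm lborel f \<partial>lborel)"
    by (simp add: nn_integral_cmult_indicator)
  also have "\<dots> \<le> (\<integral>\<^sup>+ s\<in>{0..<1}. (\<Sum>n. ennreal ((cmod (FT f (s - of_int (int_decode n))))\<^sup>2)) \<partial>lborel)"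
    by (intro nn_integral_mono mult_right_mono sqnorm_le_FT_samples[OF f supp]) auto
  also have "\<dots> = sqnorm lborel (FT f)"
    unfolding sqnorm_def by (rule nn_integral_periodize) measurable
  finally show ?thesis .
qed

lemma sqnorm_scale:
  assumes [measurable]: "f \<in> borel_measurable borel" and "c > 0"
  shows "sqnorm lborel f = ennreal c * sqnorm lborel (\<lambda>x. f (c * x))"
  unfolding sqnorm_def using assms
  by (subst nn_integral_real_affine[where c = c and t = 0]) auto

lemma sqnorm_le_FT:
  assumes f: "f \<in> L2 lborel" and supp: "\<And>x. \<bar>x\<bar> > R \<Longrightarrow> f x = 0"
  shows "sqnorm lborel f \<le> sqnorm lborel (FT f)"
proof -
  have [measurable]: "f \<in> borel_measurable borel"
    using L2_measurable[OF f] by simp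
  \<comment> \<open>Dilation by c moves the support into [-pi, pi] as soon as R \<le> c pi; the
    maximum keeps c positive for R \<le> 0. Both norms scale by the same factor c, so the constant 1
    survives.\<close>
  define c where "c = max R 1 / pi"
  have c: "c > 0" "R \<le> c * pi" by (auto simp: c_def)
  define g where "g x = f (c * x)" for x
  have [measurable]: "g \<in> borel_measurable borel"
    unfolding g_def[abs_def] by measurable
  have fg: "sqnorm lborel f = ennreal c * sqnorm lborel g"
    unfolding g_def by (rule sqnorm_scale[OF _ c(1)]) measurable
  have "g \<in> L2 lborel"
    using f fg c(1) by (auto simp: L2_iff ennreal_mult_less_top)
  moreover have "g x = 0" if "\<bar>x\<bar> > pi" for x
  proof -
    have "c * pi < c * \<bar>x\<bar>" using that c(1) by simp
    then have "R < c * \<bar>x\<bar>" using c(2) by (rule le_less_trans[rotated])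
    then show ?thesis unfolding g_def using c(1) by (intro supp) (simp add: abs_mult)
  qed
  ultimately have g: "sqnorm lborel g \<le> sqnorm lborel (FT g)"
    by (rule sqnorm_le_FT_pi)
  have FT: "complex_of_real c * FT g (c * t) = FT f t" for t
    unfolding FT_def g_def using c(1)
    by (subst (2) lborel_integral_real_affine[where c = c and t = 0])
      (auto simp: scaleR_conv_of_real mult_ac)
  have "sqnorm lborel f \<le> ennreal c * sqnorm lborel (FT g)"
    unfolding fg by (intro mult_left_mono g) auto
  also have "\<dots> = ennreal c * (ennreal c * sqnorm lborel (\<lambda>t. FT g (c * t)))"
    by (subst sqnorm_scale[OF _ c(1), of "FT g"]) auto
  also have "\<dots> = sqnorm lborel (\<lambda>t. complex_of_real c * FT g (c * t))"
    using c(1) by (subst sqnorm_cmult) (auto simp: power2_eq_square ennreal_mult mult.assoc)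
  finally show ?thesis by (simp add: FT)
qed

section \<open>The Fourier transform in mean\<close>

definition trunc :: "nat \<Rightarrow> (real \<Rightarrow> complex) \<Rightarrow> real \<Rightarrow> complex" where
  "trunc n f x = indicator {- real n..real n} x *\<^sub>R f x"

lemma borel_measurable_trunc [measurable]:
  assumes [measurable]: "f \<in> borel_measurable borel"
  shows "trunc n f \<in> borel_measurable borel"
  unfolding trunc_def[abs_def] by measurable

lemma trunc_eq_0: "\<bar>x\<bar> > real n \<Longrightarrow> trunc n f x = 0"
  by (auto simp: trunc_def indicator_def)

lemma L2_trunc:
  assumes f: "f \<in> L2 lborel"
  shows "trunc n f \<in> L2 lborel"
proof (rule L2_mono[OF f])
  have [measurable]: "f \<in> borel_measurable borel"
    using L2_measurable[OF f] by simp
  show "trunc n f \<in> borel_measurable lborel" by measurable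
qed (simp add: trunc_def indicator_def)

lemma integrable_trunc: "f \<in> L2 lborel \<Longrightarrow> integrable lborel (trunc n f)"
  by (intro L2_supported_integrable[of _ "real n"] L2_trunc trunc_eq_0)

lemma trunc_tendsto:
  assumes f: "f \<in> L2 lborel"
  shows "(\<lambda>n. sqnorm lborel (\<lambda>x. f x - trunc n f x)) \<longlonglongrightarrow> 0"
proof -
  have [measurable]: "f \<in> borel_measurable borel"
    using L2_measurable[OF f] by simp
  have "(\<lambda>n. \<integral>\<^sup>+ x. ennreal ((cmod (f x - trunc n f x))\<^sup>2) \<partial>lborel) \<longlonglongrightarrow> (\<integral>\<^sup>+ x. 0 \<partial>(lborel :: real measure))"
  proof (rule nn_integral_dominated_convergence[where w = "\<lambda>x. ennreal ((cmod (f x))\<^sup>2)"])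
    show "(\<integral>\<^sup>+ x. ennreal ((cmod (f x))\<^sup>2) \<partial>lborel) < \<infinity>"
      using f by (simp add: L2_iff sqnorm_def)
    show "AE x in lborel. (\<lambda>n. ennreal ((cmod (f x - trunc n f x))\<^sup>2)) \<longlonglongrightarrow> 0"
    proof (rule AE_I2)
      fix x :: real
      obtain k where k: "\<bar>x\<bar> \<le> real k" using real_arch_simple by blast
      have "ennreal ((cmod (f x - trunc n f x))\<^sup>2) = 0" if "n \<ge> k" for n
      proof -
        have "\<bar>x\<bar> \<le> real n" using k that by linarith
        then show ?thesis by (simp add: trunc_def indicator_def abs_le_iff)
      qed
      then have "eventually (\<lambda>n. ennreal ((cmod (f x - trunc n f x))\<^sup>2) = 0) sequentially"
        by (auto simp: eventually_sequentially)
      then show "(\<lambda>n. ennreal ((cmod (f x - trunc n f x))\<^sup>2)) \<longlonglongrightarrow> 0"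
        by (rule tendsto_eventually)
    qed
  qed (auto simp: trunc_def indicator_def)
  then show ?thesis by (simp add: sqnorm_def)
qed

lemma is_L2_fourier_tendsto:
  assumes "is_L2_fourier f g"
  shows "(\<lambda>n. sqnorm lborel (\<lambda>t. FT (trunc n f) t - g t)) \<longlonglongrightarrow> 0"
proof -
  have "(\<lambda>n. L2_sqdist lborel
        (\<lambda>t. complex_of_real (1 / sqrt (2 * pi)) *
              (LINT x:{-real n..real n}|lborel. exp (- (\<i> * complex_of_real (x * t))) * f x)) g) \<longlonglongrightarrow> 0"
    using assms unfolding is_L2_fourier_def
    by (auto intro: filterlim_compose[OF _ filterlim_real_sequentially])
  then show ?thesis
    by (simp add: L2_sqdist_def sqnorm_def FT_def trunc_def set_lebesgue_integral_def mult_scaleR_right)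
qed

text \<open>The form in which \<open>sqnorm_triangle\<close> passes to the limit. The threshold N
  serves injectivity, where the estimate holds only once the truncation radius exceeds a fixed
  m.\<close>

lemma ennreal_le_limit_two:
  fixes a b c :: ennreal
  assumes "X \<longlonglongrightarrow> 0" "Y \<longlonglongrightarrow> b" "\<And>n::nat. n \<ge> N \<Longrightarrow> a \<le> 2 * X n + 2 * Y n"
  shows "a \<le> 2 * b"
proof (rule LIMSEQ_le_const)
  show "(\<lambda>n. 2 * X n + 2 * Y n) \<longlonglongrightarrow> 2 * b"
    using tendsto_add[OF ennreal_tendsto_cmult[OF _ assms(1), of 2] ennreal_tendsto_cmult[OF _ assms(2), of 2]]
    by simp
  show "\<exists>N. \<forall>n\<ge>N. a \<le> 2 * X n + 2 * Y n"
    using assms(3) by blast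
qed

lemma is_L2_fourier_unique:
  assumes f: "f \<in> L2 lborel" "f' \<in> L2 lborel" "AE x in lborel. f x = f' x"
    and g: "is_L2_fourier f g" "is_L2_fourier f' g'"
  shows "AE t in lborel. g t = g' t"
proof -
  have [measurable]: "f \<in> borel_measurable borel" "f' \<in> borel_measurable borel"
      "g \<in> borel_measurable borel" "g' \<in> borel_measurable borel"
    using f g by (auto simp: L2_def is_L2_fourier_def)
  have eq: "FT (trunc n f) = FT (trunc n f')" for n
    unfolding FT_def
    by (intro ext arg_cong[where f = "(*) _"] integral_cong_AE)
      (use f(3) in \<open>auto simp: trunc_def\<close>)
  have "sqnorm lborel (\<lambda>t. g t - g' t) \<le> 2 * 0"
  proof (rule ennreal_le_limit_two)
    show "(\<lambda>n. sqnorm lborel (\<lambda>t. g t - FT (trunc n f) t)) \<longlonglongrightarrow> 0"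
      using is_L2_fourier_tendsto[OF g(1)] by (subst sqnorm_minus_commute)
    show "(\<lambda>n. sqnorm lborel (\<lambda>t. FT (trunc n f) t - g' t)) \<longlonglongrightarrow> 0"
      unfolding eq by (rule is_L2_fourier_tendsto[OF g(2)])
    show "sqnorm lborel (\<lambda>t. g t - g' t) \<le> 2 * sqnorm lborel (\<lambda>t. g t - FT (trunc n f) t)
        + 2 * sqnorm lborel (\<lambda>t. FT (trunc n f) t - g' t)" if "n \<ge> 0" for n
      by (rule sqnorm_triangle) measurable
  qed
  then have "sqnorm lborel (\<lambda>t. g t - g' t) = 0" by simp
  then show ?thesis
    by (subst (asm) sqnorm_eq_0_iff) auto
qed

text \<open>Fix m and let n grow: the part of d on [-m, m] is dominated by \<open>trunc n d\<close>,
  whose norm is at most that of its transform, and the latter tends to 0 in mean because both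
  transforms have the same limit.\<close>

lemma is_L2_fourier_inj:
  assumes f: "f \<in> L2 lborel" "f' \<in> L2 lborel"
    and g: "is_L2_fourier f g" "is_L2_fourier f' g'" "AE t in lborel. g t = g' t"
  shows "AE x in lborel. f x = f' x"
proof -
  have [measurable]: "f \<in> borel_measurable borel" "f' \<in> borel_measurable borel"
      "g \<in> borel_measurable borel" "g' \<in> borel_measurable borel"
    using f g by (auto simp: L2_def is_L2_fourier_def)
  define d where "d x = f x - f' x" for x
  have d: "d \<in> L2 lborel"
    unfolding d_def[abs_def] by (intro L2_diff f)
  have [measurable]: "d \<in> borel_measurable borel"
    using L2_measurable[OF d] by simp
  have trunc_d: "trunc n d = (\<lambda>x. trunc n f x - trunc n f' x)" for n
    by (auto simp: trunc_def d_def fun_eq_iff algebra_simps)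
  have "sqnorm lborel (trunc m d) \<le> 2 * 0" for m
  proof (rule ennreal_le_limit_two)
    show "(\<lambda>n. sqnorm lborel (\<lambda>t. FT (trunc n f) t - g t)) \<longlonglongrightarrow> 0"
      by (rule is_L2_fourier_tendsto[OF g(1)])
    show "(\<lambda>n. sqnorm lborel (\<lambda>t. g' t - FT (trunc n f') t)) \<longlonglongrightarrow> 0"
      using is_L2_fourier_tendsto[OF g(2)] by (subst sqnorm_minus_commute)
    fix n assume n: "n \<ge> m"
    have "sqnorm lborel (trunc m d) \<le> sqnorm lborel (trunc n d)"
      unfolding sqnorm_def using n
      by (intro nn_integral_mono) (auto simp: trunc_def indicator_def)
    also have "\<dots> \<le> sqnorm lborel (FT (trunc n d))"
      by (rule sqnorm_le_FT[OF L2_trunc[OF d] trunc_eq_0])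
    also have "FT (trunc n d) = (\<lambda>t. FT (trunc n f) t - FT (trunc n f') t)"
      unfolding trunc_d by (intro ext FT_diff integrable_trunc f)
    also have "sqnorm lborel \<dots> \<le> 2 * sqnorm lborel (\<lambda>t. FT (trunc n f) t - g t)
        + 2 * sqnorm lborel (\<lambda>t. g t - FT (trunc n f') t)"
      by (rule sqnorm_triangle) measurable
    also have "sqnorm lborel (\<lambda>t. g t - FT (trunc n f') t) = sqnorm lborel (\<lambda>t. g' t - FT (trunc n f') t)"
      using g(3) by (intro sqnorm_cong_AE) auto
    finally show "sqnorm lborel (trunc m d) \<le> 2 * sqnorm lborel (\<lambda>t. FT (trunc n f) t - g t)
        + 2 * sqnorm lborel (\<lambda>t. g' t - FT (trunc n f') t)" .
  qed
  then have "AE x in lborel. trunc m d x = 0" for m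
    by (subst sqnorm_eq_0_iff[symmetric]) auto
  then have "AE x in lborel. \<forall>m. trunc m d x = 0"
    by (simp add: AE_all_countable)
  then show ?thesis
  proof eventually_elim
    case (elim x)
    obtain k where "\<bar>x\<bar> \<le> real k" using real_arch_simple by blast
    then have "trunc k d x = d x" by (simp add: trunc_def indicator_def abs_le_iff)
    with elim show ?case by (simp add: d_def)
  qed
qed

section \<open>Finite sums of integer translates and their transforms\<close>

lemma borel_measurable_translate [measurable]:
  assumes [measurable]: "f \<in> borel_measurable borel"
  shows "translate k f \<in> borel_measurable borel"
  unfolding translate_def by measurable

lemma sqnorm_translate:
  assumes [measurable]: "f \<in> borel_measurable borel"
  shows "sqnorm lborel (translate k f) = sqnorm lborel f"
  unfolding sqnorm_def translate_def
  by (subst nn_integral_real_affine[where c = 1 and t = "of_int k"]) auto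

lemma L2_translate: "f \<in> L2 lborel \<Longrightarrow> translate k f \<in> L2 lborel"
  by (auto simp: L2_iff sqnorm_translate)

lemma sqnorm_sum_tendsto_0:
  assumes "finite K" and meas: "\<And>k n. k \<in> K \<Longrightarrow> f k n \<in> borel_measurable M"
    and lim: "\<And>k. k \<in> K \<Longrightarrow> (\<lambda>n::nat. sqnorm M (f k n)) \<longlonglongrightarrow> 0"
  shows "(\<lambda>n. sqnorm M (\<lambda>x. \<Sum>k\<in>K. f k n x)) \<longlonglongrightarrow> 0"
  using assms
proof (induction K)
  case empty
  then show ?case by (simp add: sqnorm_def)
next
  case (insert k K)
  have [measurable]: "f k n \<in> borel_measurable M" "(\<lambda>x. \<Sum>k\<in>K. f k n x) \<in> borel_measurable M" for n
    using insert.prems(1) by (auto intro!: borel_measurable_sum)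
  have "(\<lambda>n. 2 * sqnorm M (f k n) + 2 * sqnorm M (\<lambda>x. \<Sum>k\<in>K. f k n x)) \<longlonglongrightarrow> 2 * 0 + 2 * 0"
    using insert by (intro tendsto_add ennreal_tendsto_cmult) auto
  then have lim0: "(\<lambda>n. 2 * sqnorm M (f k n) + 2 * sqnorm M (\<lambda>x. \<Sum>k\<in>K. f k n x)) \<longlonglongrightarrow> 0"
    by simp
  show ?case
    unfolding sum.insert[OF insert.hyps]
    by (rule tendsto_sandwich[OF _ _ tendsto_const lim0]) (auto intro!: always_eventually sqnorm_add_le)
qed

lemma sqnorm_mult_bounded_le:
  assumes [measurable]: "f \<in> borel_measurable M" and "\<And>x. cmod (p x) \<le> B"
  shows "sqnorm M (\<lambda>x. p x * f x) \<le> ennreal (B\<^sup>2) * sqnorm M f"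
proof -
  have "sqnorm M (\<lambda>x. p x * f x) \<le> (\<integral>\<^sup>+ x. ennreal (B\<^sup>2) * ennreal ((cmod (f x))\<^sup>2) \<partial>M)"
    unfolding sqnorm_def
    by (intro nn_integral_mono)
      (auto simp: norm_mult power_mult_distrib assms(2) simp flip: ennreal_mult intro!: ennreal_leI mult_right_mono power_mono)
  then show ?thesis
    by (simp add: sqnorm_def nn_integral_cmult)
qed

text \<open>The constant 4 is an artefact of using only the lower Plancherel inequality.\<close>

lemma sqnorm_sum_translate_le:
  assumes f: "f \<in> L2 lborel" and g: "is_L2_fourier f g" and K: "finite K"
  shows "sqnorm lborel (\<lambda>x. \<Sum>k\<in>K. c k * translate k f x)
    \<le> 4 * sqnorm lborel (\<lambda>t. (\<Sum>k\<in>K. c k * trig k t) * g t)"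
proof -
  have [measurable]: "f \<in> borel_measurable borel" "g \<in> borel_measurable borel"
    using f g by (auto simp: L2_def is_L2_fourier_def)
  define p where "p t = (\<Sum>k\<in>K. c k * trig k t)" for t
  define s where "s h x = (\<Sum>k\<in>K. c k * translate k h x)" for h x
  define B where "B = (\<Sum>k\<in>K. cmod (c k))"
  have [measurable]: "p \<in> borel_measurable borel"
    unfolding p_def[abs_def] by measurable
  have [measurable]: "s h \<in> borel_measurable borel" if [measurable]: "h \<in> borel_measurable borel" for h
    unfolding s_def[abs_def] by measurable
  have p_le: "cmod (p t) \<le> B" for t
    unfolding p_def B_def by (rule order_trans[OF norm_sum]) (simp add: norm_mult)
  have "(\<lambda>n. sqnorm lborel (\<lambda>x. \<Sum>k\<in>K. c k * translate k (\<lambda>x. f x - trunc n f x) x)) \<longlonglongrightarrow> 0"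
  proof (rule sqnorm_sum_tendsto_0[OF K])
    fix k
    have "(\<lambda>n. ennreal ((cmod (c k))\<^sup>2) * sqnorm lborel (\<lambda>x. f x - trunc n f x)) \<longlonglongrightarrow> ennreal ((cmod (c k))\<^sup>2) * 0"
      by (intro ennreal_tendsto_cmult trunc_tendsto f) auto
    then show "(\<lambda>n. sqnorm lborel (\<lambda>x. c k * translate k (\<lambda>x. f x - trunc n f x) x)) \<longlonglongrightarrow> 0"
      by (simp add: sqnorm_cmult sqnorm_translate)
  qed measurable
  also have "(\<lambda>n. sqnorm lborel (\<lambda>x. \<Sum>k\<in>K. c k * translate k (\<lambda>x. f x - trunc n f x) x)) =
      (\<lambda>n. sqnorm lborel (\<lambda>x. s f x - s (trunc n f) x))"
    by (simp add: s_def translate_def sum_subtractf right_diff_distrib)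
  finally have lim1: "(\<lambda>n. sqnorm lborel (\<lambda>x. s f x - s (trunc n f) x)) \<longlonglongrightarrow> 0" .
  have "(\<lambda>n. ennreal (B\<^sup>2) * sqnorm lborel (\<lambda>t. FT (trunc n f) t - g t)) \<longlonglongrightarrow> ennreal (B\<^sup>2) * 0"
    by (intro ennreal_tendsto_cmult is_L2_fourier_tendsto g) auto
  then have "(\<lambda>n. 2 * (ennreal (B\<^sup>2) * sqnorm lborel (\<lambda>t. FT (trunc n f) t - g t)) + 2 * sqnorm lborel (\<lambda>t. p t * g t))
      \<longlonglongrightarrow> 2 * 0 + 2 * sqnorm lborel (\<lambda>t. p t * g t)"
    by (intro tendsto_add ennreal_tendsto_cmult tendsto_const) auto
  then have lim2: "(\<lambda>n. 2 * (ennreal (B\<^sup>2) * sqnorm lborel (\<lambda>t. FT (trunc n f) t - g t)) + 2 * sqnorm lborel (\<lambda>t. p t * g t))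
      \<longlonglongrightarrow> 2 * sqnorm lborel (\<lambda>t. p t * g t)" by simp
  \<comment> \<open>One factor 2 comes from replacing f by its truncation, the other from replacing
    the transform of the truncation by g.\<close>
  have "sqnorm lborel (s f) \<le> 2 * (2 * sqnorm lborel (\<lambda>t. p t * g t))"
  proof (rule ennreal_le_limit_two[OF lim1 lim2])
    fix n :: nat assume "n \<ge> 0"
    have sn: "s (trunc n f) \<in> L2 lborel"
      unfolding s_def[abs_def] by (intro L2_sum L2_cmult L2_translate L2_trunc f)
    \<comment> \<open>Translation by k moves the support by at most |k|; the sum over K is a crude
      bound for all these shifts and is also defined for empty K.\<close>
    define R where "R = real n + real_of_int (\<Sum>k\<in>K. \<bar>k\<bar>)"
    have "s (trunc n f) x = 0" if "\<bar>x\<bar> > R" for x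
      unfolding s_def
    proof (rule sum.neutral, rule ballI)
      fix k assume "k \<in> K"
      then have "\<bar>k\<bar> \<le> (\<Sum>k\<in>K. \<bar>k\<bar>)"
        using K by (intro member_le_sum) auto
      then have "real_of_int \<bar>k\<bar> \<le> real_of_int (\<Sum>k\<in>K. \<bar>k\<bar>)" by linarith
      then have "\<bar>x - of_int k\<bar> > real n"
        using that unfolding R_def by linarith
      then show "c k * translate k (trunc n f) x = 0"
        by (simp add: translate_def trunc_eq_0)
    qed
    then have "sqnorm lborel (s (trunc n f)) \<le> sqnorm lborel (FT (s (trunc n f)))"
      using sqnorm_le_FT[OF sn] by blast
    also have "FT (s (trunc n f)) = (\<lambda>t. p t * FT (trunc n f) t)"
      unfolding s_def[abs_def] p_def by (intro ext FT_sum_translate integrable_trunc f)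
    also have "sqnorm lborel \<dots> = sqnorm lborel (\<lambda>t. p t * (FT (trunc n f) t - g t) + p t * g t)"
      by (simp add: algebra_simps)
    also have "\<dots> \<le> 2 * sqnorm lborel (\<lambda>t. p t * (FT (trunc n f) t - g t)) + 2 * sqnorm lborel (\<lambda>t. p t * g t)"
      by (rule sqnorm_add_le) measurable
    also have "\<dots> \<le> 2 * (ennreal (B\<^sup>2) * sqnorm lborel (\<lambda>t. FT (trunc n f) t - g t)) + 2 * sqnorm lborel (\<lambda>t. p t * g t)"
      by (intro add_right_mono mult_left_mono sqnorm_mult_bounded_le p_le) auto
    finally have sn_le: "sqnorm lborel (s (trunc n f)) \<le> \<dots>" .
    have "sqnorm lborel (s f) \<le> 2 * sqnorm lborel (\<lambda>x. s f x - s (trunc n f) x) + 2 * sqnorm lborel (s (trunc n f))"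
      using sqnorm_add_le[of "\<lambda>x. s f x - s (trunc n f) x" lborel "s (trunc n f)"] by simp
    also have "\<dots> \<le> 2 * sqnorm lborel (\<lambda>x. s f x - s (trunc n f) x) +
        2 * (2 * (ennreal (B\<^sup>2) * sqnorm lborel (\<lambda>t. FT (trunc n f) t - g t)) + 2 * sqnorm lborel (\<lambda>t. p t * g t))"
      by (intro add_left_mono mult_left_mono sn_le) auto
    finally show "sqnorm lborel (s f) \<le> \<dots>" .
  qed
  then show ?thesis
    by (simp add: s_def[abs_def] p_def mult.assoc[symmetric])
qed

section \<open>Periodic zero sets and the refinement equation\<close>

text \<open>The value type is arbitrary so that the rule applies to membership in a periodic set as
  well as to the filters.\<close>

lemma periodic_int:
  fixes f :: "real \<Rightarrow> 'a"
  assumes "\<And>t. f (t + 2 * pi) = f t"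
  shows "f (t + of_int m * (2 * pi)) = f t"
proof -
  have *: "f (t + real n * (2 * pi)) = f t" for n t
  proof (induction n)
    case (Suc n)
    have "f (t + real (Suc n) * (2 * pi)) = f ((t + real n * (2 * pi)) + 2 * pi)"
      by (simp add: algebra_simps)
    then show ?case using Suc assms by simp
  qed simp
  show ?thesis
  proof (cases "m \<ge> 0")
    case True
    then show ?thesis using *[of t "nat m"] by simp
  next
    case False
    then show ?thesis using *[of "t + of_int m * (2 * pi)" "nat (- m)"] by simp
  qed
qed

lemma Arg_cis_periodic:
  obtains m :: int where "Arg (cis t) = t + of_int m * (2 * pi)"
proof -
  have "cis (Arg (cis t)) = cis t"
    using cis_Arg[of "cis t"] by (simp add: sgn_if sgn_div_norm)
  then have "sin (Arg (cis t)) = sin t \<and> cos (Arg (cis t)) = cos t"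
    by (simp add: complex_eq_iff)
  then obtain m :: int where "Arg (cis t) = t + of_int m * (2 * pi)"
    unfolding sin_cos_eq_iff by (auto simp: mult_ac)
  then show ?thesis using that by blast
qed

text \<open>By orthogonality the polynomial on the arc and the sum of translates have square norms 2
  pi and 1 times the sum of |c_k|^2. Passing from translates to transforms costs 4, whence 8
  pi.\<close>

lemma sqnorm_trig_poly_le:
  assumes f: "f \<in> L2 lborel" and g: "is_L2_fourier f g" and K: "finite K"
    and orth: "\<And>k l. L2_inner (translate k f) (translate l f) = (if k = l then 1 else 0)"
  shows "sqnorm arc (\<lambda>t. \<Sum>k\<in>K. c k * trig k t) \<le>
    ennreal (8 * pi) * sqnorm lborel (\<lambda>t. (\<Sum>k\<in>K. c k * trig k t) * g t)"
proof -
  have "sqnorm arc (\<lambda>t. \<Sum>k\<in>K. c k * trig k t) = ennreal (2 * pi * (\<Sum>k\<in>K. (cmod (c k))\<^sup>2))"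
    by (subst sqnorm_eq_integral) (simp_all add: L2_sum L2_cmult trig_L2_arc
        orthogonal_sum_norm_sq[OF trig_L2_arc trig_orthogonal K])
  also have "\<dots> = ennreal (2 * pi) * sqnorm lborel (\<lambda>x. \<Sum>k\<in>K. c k * translate k f x)"
  proof -
    have "(LINT x|lborel. (cmod (\<Sum>k\<in>K. c k * translate k f x))\<^sup>2) = 1 * (\<Sum>k\<in>K. (cmod (c k))\<^sup>2)"
      by (rule orthogonal_sum_norm_sq[OF L2_translate[OF f] _ K]) (use orth in \<open>auto simp: L2_inner_def\<close>)
    then have "sqnorm lborel (\<lambda>x. \<Sum>k\<in>K. c k * translate k f x) = ennreal (\<Sum>k\<in>K. (cmod (c k))\<^sup>2)"
      by (subst sqnorm_eq_integral) (simp_all add: L2_sum L2_cmult L2_translate f)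
    then show ?thesis by (simp add: ennreal_mult sum_nonneg)
  qed
  also have "\<dots> \<le> ennreal (2 * pi) * (4 * sqnorm lborel (\<lambda>t. (\<Sum>k\<in>K. c k * trig k t) * g t))"
    by (intro mult_left_mono sqnorm_sum_translate_le f g K) auto
  also have "\<dots> = ennreal (8 * pi) * sqnorm lborel (\<lambda>t. (\<Sum>k\<in>K. c k * trig k t) * g t)"
  proof -
    have "ennreal (8 * pi) = ennreal (2 * pi) * 4"
      by (subst ennreal_numeral[symmetric], subst ennreal_mult[symmetric]) auto
    then show ?thesis by (simp add: mult.assoc)
  qed
  finally show ?thesis .
qed

text \<open>Orthonormality of the translates classically says that the sum of |g(t + 2 pi k)|^2 over
  k is 1/(2 pi) almost everywhere, which excludes a periodic zero set of positive measure. Here the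
  bound \<open>sqnorm_trig_poly_le\<close> does the same: a polynomial close to the indicator of E
  cannot have small norm on the arc, yet its product with g is small.\<close>

lemma fourier_zero_periodic_null:
  assumes f: "f \<in> L2 lborel" and g: "is_L2_fourier f g"
    and orth: "\<And>k l. L2_inner (translate k f) (translate l f) = (if k = l then 1 else 0)"
    and E [measurable]: "E \<in> sets borel" and per: "\<And>t. t + 2 * pi \<in> E \<longleftrightarrow> t \<in> E"
    and zero: "AE t in lborel. t \<in> E \<longrightarrow> g t = 0"
  shows "AE t in lborel. t \<notin> E"
proof -
  have [measurable]: "g \<in> borel_measurable borel" and gL: "g \<in> L2 lborel"
    using g by (auto simp: L2_def is_L2_fourier_def)
  have per': "t + of_int m * (2 * pi) \<in> E \<longleftrightarrow> t \<in> E" for t m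
    using periodic_int[of "\<lambda>t. t \<in> E"] per by blast
  \<comment> \<open>Approximating the indicator of \<open>E\<close> simultaneously in the arc and in the weight
    \<open>|g|\<^sup>2\<close> gives polynomials \<open>p\<close> close to 1 on \<open>E\<close> for which \<open>p g\<close> is small.\<close>
  define w where "w t = indicator {-pi..pi} t + (cmod (g t))\<^sup>2" for t
  define \<mu> where "\<mu> = density lborel (\<lambda>t. ennreal (w t))"
  have w [measurable]: "w \<in> borel_measurable borel"
    unfolding w_def[abs_def] by measurable
  have [simp, measurable_cong]: "sets \<mu> = sets borel"
    by (simp add: \<mu>_def)
  have split: "sqnorm \<mu> u = sqnorm arc u + sqnorm lborel (\<lambda>t. u t * g t)"
    if [measurable]: "u \<in> borel_measurable borel" for u
  proof -
    have "sqnorm \<mu> u = (\<integral>\<^sup>+ t. ennreal (w t) * ennreal ((cmod (u t))\<^sup>2) \<partial>lborel)"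
      unfolding sqnorm_def \<mu>_def by (subst nn_integral_density) auto
    also have "\<dots> = (\<integral>\<^sup>+ t. ennreal (indicator {-pi..pi} t) * ennreal ((cmod (u t))\<^sup>2) +
        ennreal ((cmod (u t * g t))\<^sup>2) \<partial>lborel)"
      by (intro nn_integral_cong)
        (simp add: w_def norm_mult power_mult_distrib ennreal_mult distrib_right mult.commute[of "ennreal ((cmod (g _))\<^sup>2)"])
    also have "\<dots> = sqnorm arc u + sqnorm lborel (\<lambda>t. u t * g t)"
      unfolding sqnorm_def arc_def by (subst nn_integral_add; (subst nn_integral_density)?) auto
    finally show ?thesis .
  qed
  have fin: "finite_measure \<mu>"
  proof (rule finite_measureI)
    have "emeasure \<mu> (space \<mu>) = sqnorm \<mu> (\<lambda>_. 1)"
      by (simp add: sqnorm_def)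
    also have "\<dots> = sqnorm arc (\<lambda>_. 1) + sqnorm lborel g"
      by (subst split) auto
    also have "\<dots> < \<infinity>"
      using L2_arc_bounded[of "\<lambda>_. 1" 1] gL by (simp add: L2_iff)
    finally show "emeasure \<mu> (space \<mu>) \<noteq> \<infinity>" by simp
  qed
  \<comment> \<open>Periodicity of E makes its indicator a function of \<open>cis t\<close>, as
    \<open>trig_polys_dense\<close> requires.\<close>
  define F where "F z = (indicator E (Arg z) :: complex)" for z
  have Fm: "F \<in> borel_measurable borel"
    unfolding F_def[abs_def] by measurable
  have F: "F (cis t) = indicator E t" for t
  proof -
    obtain m where "Arg (cis t) = t + of_int m * (2 * pi)" by (rule Arg_cis_periodic)
    then show ?thesis using per'[of t m] by (simp add: F_def indicator_def)
  qed
  have "sqnorm \<mu> (\<lambda>t. F (cis t)) \<le> sqnorm \<mu> (\<lambda>t. 1)"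
    unfolding sqnorm_def by (intro nn_integral_mono) (auto simp: F indicator_def)
  also have "\<dots> < \<infinity>"
    using finite_measure.emeasure_finite[OF fin, of "space \<mu>"] by (simp add: sqnorm_def less_top)
  finally have dense: "approximable \<mu> trig_polys (\<lambda>t. indicator E t)"
    using trig_polys_dense[OF fin _ Fm] by (simp add: F)
  have "sqnorm arc (indicator E) = 0"
  proof (rule ccontr)
    assume "sqnorm arc (indicator E) \<noteq> 0"
    moreover have "sqnorm arc (indicator E) < \<infinity>"
      using L2_arc_bounded[of "indicator E" 1] by (auto simp: L2_iff indicator_def)
    ultimately obtain r where r: "sqnorm arc (indicator E) = ennreal r" "r > 0"
      by (cases "sqnorm arc (indicator E)") (auto simp: ennreal_eq_0_iff not_le)
    \<comment> \<open>The estimate below ends in r \<le> (2 + 16 pi) e; with this e the right side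
      is r / 2, a contradiction.\<close>
    define e where "e = r / (2 * (2 + 16 * pi))"
    have e: "e > 0" using r by (simp add: e_def add_pos_pos)
    obtain p where p: "p \<in> trig_polys" "sqnorm \<mu> (\<lambda>t. indicator E t - p t) < ennreal e"
      using dense e unfolding approximable_def by blast
    have [measurable]: "p \<in> borel_measurable borel"
      by (rule borel_measurable_trig_polys[OF p(1)])
    obtain K c where K: "finite K" "p = (\<lambda>t. \<Sum>k\<in>K. c k * trig k t)"
      using trig_polys_eq_sum[OF p(1)] .
    have sum: "sqnorm arc (\<lambda>t. indicator E t - p t) + sqnorm lborel (\<lambda>t. (indicator E t - p t) * g t) < ennreal e"
      using p(2) by (subst (asm) split) auto
    have arc_less: "sqnorm arc (\<lambda>t. indicator E t - p t) \<le> ennreal e"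
      using sum by (meson add_increasing2 le_less_trans less_imp_le order_refl zero_le)
    have line_less: "sqnorm lborel (\<lambda>t. (indicator E t - p t) * g t) \<le> ennreal e"
      using sum by (meson add_increasing le_less_trans less_imp_le order_refl zero_le)
    \<comment> \<open>The indicator term drops out: off E the indicator is 0, and on E the function
      g vanishes almost everywhere.\<close>
    have "sqnorm lborel (\<lambda>t. (indicator E t - p t) * g t) = sqnorm lborel (\<lambda>t. (- 1) * (p t * g t))"
      using zero by (intro sqnorm_cong_AE) (auto simp: indicator_def)
    also have "\<dots> = sqnorm lborel (\<lambda>t. p t * g t)"
      by (subst sqnorm_cmult) auto
    finally have pg: "sqnorm lborel (\<lambda>t. p t * g t) \<le> ennreal e"
      using line_less by simp
    have "sqnorm arc p \<le> ennreal (8 * pi) * sqnorm lborel (\<lambda>t. p t * g t)"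
      unfolding K(2) by (rule sqnorm_trig_poly_le[OF f g K(1) orth])
    also have "\<dots> \<le> ennreal (8 * pi) * ennreal e"
      by (intro mult_left_mono pg) auto
    finally have pa: "sqnorm arc p \<le> ennreal (8 * pi) * ennreal e" .
    have "sqnorm arc (indicator E) \<le> 2 * sqnorm arc (\<lambda>t. indicator E t - p t) + 2 * sqnorm arc p"
      using sqnorm_add_le[of "\<lambda>t. indicator E t - p t" arc p] by simp
    also have "\<dots> \<le> 2 * ennreal e + 2 * (ennreal (8 * pi) * ennreal e)"
      by (intro add_mono mult_left_mono arc_less pa) auto
    also have "\<dots> = ennreal (2 * e + 2 * (8 * pi * e))"
    proof -
      have two: "ennreal (2 * x) = 2 * ennreal x" if "x \<ge> 0" for x
        using that by (subst ennreal_mult) auto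
      have eight: "ennreal (8 * pi) * ennreal e = ennreal (8 * pi * e)"
        using e by (intro ennreal_mult[symmetric]) auto
      have "ennreal (2 * e + 2 * (8 * pi * e)) = ennreal (2 * e) + ennreal (2 * (8 * pi * e))"
        using e by (intro ennreal_plus) auto
      also have "\<dots> = 2 * ennreal e + 2 * ennreal (8 * pi * e)"
        using e by (intro arg_cong2[where f = "(+)"] two) auto
      finally show ?thesis by (simp only: eight)
    qed
    finally have "ennreal r \<le> ennreal (2 * e + 2 * (8 * pi * e))"
      unfolding r(1) .
    then have "r \<le> 2 * e + 2 * (8 * pi * e)"
      using e by (subst (asm) ennreal_le_iff) auto
    also have "\<dots> = (2 + 16 * pi) * e" by (simp add: algebra_simps)
    also have "\<dots> = r / 2"
    proof -
      have "q * (r / (2 * q)) = r / 2" if "q \<noteq> 0" for q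
        using that by simp
      moreover have "2 + 16 * pi \<noteq> 0"
        using pi_gt_zero by linarith
      ultimately show ?thesis
        unfolding e_def by blast
    qed
    finally show False using r(2) by simp
  qed
  then have "AE t in arc. t \<notin> E"
    by (subst (asm) sqnorm_eq_0_iff) (auto simp: indicator_def)
  then have "AE t in lborel. t \<in> {-pi..pi} \<longrightarrow> t \<notin> E"
    unfolding arc_def by (subst (asm) AE_density) (auto simp: indicator_def)
  \<comment> \<open>Countably many translates of the arc cover the line, and E is invariant under
    these translations.\<close>
  then have "AE t in lborel. of_int m * (2 * pi) + 1 * t \<in> {-pi..pi} \<longrightarrow> of_int m * (2 * pi) + 1 * t \<notin> E" for m :: int
    by (intro AE_borel_affine) measurable
  then have "AE t in lborel. \<forall>m::int. of_int m * (2 * pi) + 1 * t \<in> {-pi..pi} \<longrightarrow> of_int m * (2 * pi) + 1 * t \<notin> E"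
    by (simp add: AE_all_countable)
  then show ?thesis
  proof eventually_elim
    case (elim t)
    obtain m where m: "Arg (cis t) = t + of_int m * (2 * pi)" by (rule Arg_cis_periodic)
    have "of_int m * (2 * pi) + 1 * t \<in> {-pi..pi}"
      using Arg_bounded[of "cis t"] m by auto
    then show ?case
      using elim per'[of t m] by (auto simp: add.commute)
  qed
qed

section \<open>Refinement equations and infinite products\<close>

text \<open>P may be non-measurable, so the substitution is made in a Borel null set that contains
  the exceptions.\<close>

lemma AE_scale:
  fixes P :: "real \<Rightarrow> bool"
  assumes "AE x in lborel. P x" "c \<noteq> 0"
  shows "AE x in lborel. P (c * x)"
proof -
  obtain N where N: "{x \<in> space lborel. \<not> P x} \<subseteq> N" "emeasure lborel N = 0" "N \<in> sets lborel"
    using AE_E[OF assms(1)] .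
  have [measurable]: "N \<in> sets borel" using N(3) by simp
  have "AE x in lborel. x \<notin> N"
    using N by (intro AE_not_in) auto
  then have "AE x in lborel. 0 + c * x \<notin> N"
    using assms(2) by (intro AE_borel_affine) auto
  then show ?thesis using N(1) by (auto elim!: eventually_mono)
qed

lemma product_formula_refinement:
  assumes "product_formula p m h" "p \<ge> 2"
  shows "AE t in lborel. complex_of_real (sqrt (real p)) * h (real p * t) = m t * h t"
proof -
  define C where "C = complex_of_real (1 / sqrt (2 * pi))"
  define P where "P n t = (\<Prod>k=1..n. complex_of_real (1 / sqrt (real p)) * m (t / real p ^ k))" for n t
  have 1: "AE t in lborel. (\<lambda>n. C * P n t) \<longlonglongrightarrow> h t"
    using assms(1) by (simp add: product_formula_def C_def P_def)
  then have 2: "AE t in lborel. (\<lambda>n. C * P n (real p * t)) \<longlonglongrightarrow> h (real p * t)"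
    by (rule AE_scale) (use assms(2) in simp)
  \<comment> \<open>At the point p t the factor with k = 1 is evaluated at t itself, and the
    remaining n factors are exactly those of P n t.\<close>
  have P_Suc: "P (Suc n) (real p * t) = complex_of_real (1 / sqrt (real p)) * m t * P n t" for n t
    unfolding P_def using assms(2)
    by (induction n) (simp_all add: field_simps)
  from 1 2 show ?thesis
  proof eventually_elim
    case (elim t)
    have "(\<lambda>n. C * P (Suc n) (real p * t)) \<longlonglongrightarrow> h (real p * t)"
      using elim(2) by (rule LIMSEQ_Suc)
    moreover have "(\<lambda>n. C * P (Suc n) (real p * t)) \<longlonglongrightarrow> complex_of_real (1 / sqrt (real p)) * m t * h t"
      unfolding P_Suc using tendsto_mult_left[OF elim(1), of "complex_of_real (1 / sqrt (real p)) * m t"]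
      by (simp add: mult_ac)
    ultimately have "h (real p * t) = complex_of_real (1 / sqrt (real p)) * m t * h t"
      by (rule LIMSEQ_unique)
    then show ?case using assms(2) by (simp add: field_simps)
  qed
qed

text \<open>Iterating the equation gives g(t) = P_n(t) g(t / p^n); the partial products tend to
  sqrt(2 pi) h(t) and the last factor to l. A limit along almost every orbit is assumed instead of
  continuity at 0, since the solution built from the other filter is controlled only along
  orbits.\<close>

lemma refinement_solution_unique:
  assumes h: "product_formula p m h" and p: "p \<ge> 2"
    and g: "AE t in lborel. complex_of_real (sqrt (real p)) * g (real p * t) = m t * g t"
    and lim: "AE t in lborel. (\<lambda>n. g (t / real p ^ n)) \<longlonglongrightarrow> l"
  shows "AE t in lborel. g t = complex_of_real (sqrt (2 * pi)) * l * h t"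
proof -
  define C where "C = complex_of_real (1 / sqrt (2 * pi))"
  define P where "P n t = (\<Prod>k=1..n. complex_of_real (1 / sqrt (real p)) * m (t / real p ^ k))" for n t
  have 1: "AE t in lborel. (\<lambda>n. C * P n t) \<longlonglongrightarrow> h t"
    using h by (simp add: product_formula_def C_def P_def)
  \<comment> \<open>The exponent \<open>Suc n\<close> makes the equation link t / p^n to t /
    p^(n+1). The countably many exceptional sets are then merged into one.\<close>
  have "AE t in lborel. complex_of_real (sqrt (real p)) * g (real p * ((1 / real p ^ Suc n) * t))
      = m ((1 / real p ^ Suc n) * t) * g ((1 / real p ^ Suc n) * t)" for n
    by (rule AE_scale[OF g]) (use p in simp)
  then have 2: "AE t in lborel. \<forall>n. complex_of_real (sqrt (real p)) * g (real p * ((1 / real p ^ Suc n) * t))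
      = m ((1 / real p ^ Suc n) * t) * g ((1 / real p ^ Suc n) * t)"
    by (simp add: AE_all_countable)
  from 1 2 lim show ?thesis
  proof eventually_elim
    case (elim t)
    have step: "g (t / real p ^ n) = complex_of_real (1 / sqrt (real p)) * m (t / real p ^ Suc n) * g (t / real p ^ Suc n)" for n
    proof -
      have "real p * ((1 / real p ^ Suc n) * t) = t / real p ^ n" "(1 / real p ^ Suc n) * t = t / real p ^ Suc n"
        using p by (simp_all add: field_simps)
      with elim(2)[rule_format, of n]
      have "complex_of_real (sqrt (real p)) * g (t / real p ^ n) = m (t / real p ^ Suc n) * g (t / real p ^ Suc n)"
        by simp
      then show ?thesis using p by (simp add: field_simps del: power_Suc)
    qed
    have gP: "g t = P n t * g (t / real p ^ n)" for n
    proof (induction n)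
      case (Suc n)
      have "g t = P n t * g (t / real p ^ n)" by (rule Suc)
      also have "\<dots> = P (Suc n) t * g (t / real p ^ Suc n)"
        unfolding step[of n] P_def by (simp del: power_Suc)
      finally show ?case .
    qed (simp add: P_def)
    have "(\<lambda>n. C * P n t * g (t / real p ^ n)) \<longlonglongrightarrow> h t * l"
      by (intro tendsto_mult elim)
    moreover have "(\<lambda>n. C * P n t * g (t / real p ^ n)) = (\<lambda>n. C * g t)"
      using gP by (simp add: mult.assoc)
    ultimately have "C * g t = h t * l"
      by (simp add: LIMSEQ_const_iff)
    then show ?case by (simp add: C_def field_simps)
  qed
qed

section \<open>The equivalence\<close>

lemma father_function_L2: "father_function p \<phi> \<Longrightarrow> \<phi> \<in> L2 lborel"
  by (simp add: father_function_def)

lemma father_function_orthonormal: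
  "father_function p \<phi> \<Longrightarrow> L2_inner (translate k \<phi>) (translate l \<phi>) = (if k = l then 1 else 0)"
  by (simp add: father_function_def)

lemma father_function_not_AE_0:
  assumes "father_function p \<phi>"
  shows "\<not> (AE x in lborel. \<phi> x = 0)"
proof
  assume "AE x in lborel. \<phi> x = 0"
  moreover have "translate 0 \<phi> = \<phi>"
    by (simp add: translate_def)
  ultimately have "L2_inner (translate 0 \<phi>) (translate 0 \<phi>) = 0"
    unfolding L2_inner_def by (intro integral_eq_zero_AE) auto
  then show False
    using father_function_orthonormal[OF assms, of 0 0] by simp
qed

lemma is_L2_fourier_0: "is_L2_fourier (\<lambda>x. 0) (\<lambda>t. 0)"
  by (simp add: is_L2_fourier_def L2_def L2_sqdist_def)

lemma tendsto_divide_power: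
  fixes h :: "real \<Rightarrow> complex"
  assumes "isCont h 0" "p \<ge> 2"
  shows "(\<lambda>n. h (t / real p ^ n)) \<longlonglongrightarrow> h 0"
proof (rule isCont_tendsto_compose[OF assms(1)])
  have "(\<lambda>n. t * inverse (real p) ^ n) \<longlonglongrightarrow> t * 0"
    using assms(2) by (intro tendsto_mult tendsto_const LIMSEQ_power_zero) (simp add: divide_simps)
  then show "(\<lambda>n. t / real p ^ n) \<longlonglongrightarrow> 0"
    by (simp add: divide_inverse power_inverse)
qed

text \<open>By uniqueness applied to h itself, h is sqrt(2 pi) h(0) times h almost everywhere. A
  factor other than 1 would force h to vanish, and then the father function too, contradicting its
  norm 1.\<close>

lemma father_function_fourier_at_0:
  assumes \<phi>: "father_function p \<phi>" and h: "is_L2_fourier \<phi> h" "isCont h 0"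
    and prod: "product_formula p m h" and p: "p \<ge> 2"
  shows "complex_of_real (sqrt (2 * pi)) * h 0 = 1"
proof (rule ccontr)
  assume *: "complex_of_real (sqrt (2 * pi)) * h 0 \<noteq> 1"
  have "AE t in lborel. h t = complex_of_real (sqrt (2 * pi)) * h 0 * h t"
    using product_formula_refinement[OF prod p]
    by (intro refinement_solution_unique[OF prod p]) (auto intro!: always_eventually tendsto_divide_power h p)
  then have "AE t in lborel. h t = 0"
    by eventually_elim (use * in \<open>metis mult_cancel_right1 mult.commute\<close>)
  moreover have "(\<lambda>x. 0) \<in> L2 lborel"
    by (simp add: L2_def)
  ultimately have "AE x in lborel. \<phi> x = 0"
    using is_L2_fourier_inj[OF father_function_L2[OF \<phi>] _ h(1) is_L2_fourier_0] by simp
  with father_function_not_AE_0[OF \<phi>] show False by blast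
qed

lemma L2_circle_const: "(\<lambda>t. c) \<in> L2_circle"
proof -
  have "finite_measure circle"
  proof (rule finite_measureI)
    have "emeasure circle (space circle) = emeasure lborel {-pi..pi}"
      unfolding circle_def by (subst emeasure_restrict_space) (auto simp: space_restrict_space)
    then show "emeasure circle (space circle) \<noteq> \<infinity>" by simp
  qed
  then interpret finite_measure circle .
  show ?thesis
    by (simp add: L2_circle_def L2_def)
qed

text \<open>Both composites multiply \<xi>(2 N t), by m(t) M(2t) and by M(t) m(N t) respectively;
  the constant function 1 recovers the multipliers.\<close>

lemma commutation_iff:
  fixes m M :: "real \<Rightarrow> complex"
  shows "(AE t in lborel. m (real N * t) * M t = m t * M (2 * t)) \<longleftrightarrow>
    (\<forall>\<xi>\<in>L2_circle. AE t in lborel.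
       filter_op 2 m (filter_op N M \<xi>) t = filter_op N M (filter_op 2 m \<xi>) t)"
    (is "?ii \<longleftrightarrow> ?iii")
proof
  assume ?ii
  show ?iii
  proof
    fix \<xi>
    from \<open>?ii\<close> show "AE t in lborel. filter_op 2 m (filter_op N M \<xi>) t = filter_op N M (filter_op 2 m \<xi>) t"
    proof eventually_elim
      case (elim t)
      have "real N * (2 * t) = 2 * (real N * t)" by simp
      then show ?case
        using elim by (simp add: filter_op_def mult.assoc[symmetric]) (simp add: mult_ac)
    qed
  qed
next
  assume ?iii
  then have "AE t in lborel. filter_op 2 m (filter_op N M (\<lambda>_. 1)) t = filter_op N M (filter_op 2 m (\<lambda>_. 1)) t"
    using L2_circle_const by blast
  then show ?ii
    by eventually_elim (simp add: filter_op_def mult_ac)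
qed

lemma fourier_eq_of_commutation:
  fixes h H m M :: "real \<Rightarrow> complex"
  assumes N: "N \<ge> 2" and comm: "AE t in lborel. m (real N * t) * M t = m t * M (2 * t)"
    and h: "isCont h 0" "complex_of_real (sqrt (2 * pi)) * h 0 = 1" "product_formula 2 m h"
    and H: "isCont H 0" "complex_of_real (sqrt (2 * pi)) * H 0 = 1" "product_formula N M H"
  shows "AE t in lborel. h t = H t"
proof -
  let ?r = "complex_of_real (sqrt (real N))"
  have r: "?r \<noteq> 0" using N by simp
  have R2: "AE t in lborel. complex_of_real (sqrt 2) * h (2 * t) = m t * h t"
    using product_formula_refinement[OF h(3)] by simp
  have RN: "AE t in lborel. ?r * H (real N * t) = M t * H t"
    by (rule product_formula_refinement[OF H(3) N])
  \<comment> \<open>Both values are the inverse of sqrt(2 pi).\<close>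
  have h0: "H 0 = h 0" "H 0 \<noteq> 0"
    using inverse_unique[OF h(2)] inverse_unique[OF H(2)] H(2) by auto
  define g where "g t = M ((1 / real N) * t) * h ((1 / real N) * t) / ?r" for t
  have "AE t in lborel. complex_of_real (sqrt 2) * h (2 * t) = m t * h t \<and>
      m (real N * t) * M t = m t * M (2 * t)"
    using R2 comm by eventually_elim simp
  then have "AE t in lborel. complex_of_real (sqrt 2) * h (2 * ((1 / real N) * t)) = m ((1 / real N) * t) * h ((1 / real N) * t) \<and>
      m (real N * ((1 / real N) * t)) * M ((1 / real N) * t) = m ((1 / real N) * t) * M (2 * ((1 / real N) * t))"
    by (rule AE_scale) (use N in simp)
  \<comment> \<open>With u = t / N the chain is: the scale-2 equation turns h(2u) into m(u) h(u),
    and commutation turns m(u) M(2u) into m(t) M(u), leaving m(t) g(t).\<close>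
  then have g: "AE t in lborel. complex_of_real (sqrt (real 2)) * g (real 2 * t) = m t * g t"
  proof eventually_elim
    case (elim t)
    define u where "u = (1 / real N) * t"
    have "real N * u = t" "(1 / real N) * (real 2 * t) = 2 * u"
      using N by (simp_all add: u_def)
    moreover have "complex_of_real (sqrt 2) * h (2 * u) = m u * h u" "m (real N * u) * M u = m u * M (2 * u)"
      using elim N by (auto simp: u_def)
    ultimately show ?case
      unfolding g_def u_def[symmetric] by (simp add: field_simps) (metis mult.commute mult.left_commute)
  qed
  have "AE t in lborel. ?r * H (real N * ((1 / (real N * 2 ^ n)) * t)) =
      M ((1 / (real N * 2 ^ n)) * t) * H ((1 / (real N * 2 ^ n)) * t)" for n :: nat
    by (rule AE_scale[OF RN]) (use N in simp)
  then have "AE t in lborel. \<forall>n::nat. ?r * H (real N * ((1 / (real N * 2 ^ n)) * t)) =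
      M ((1 / (real N * 2 ^ n)) * t) * H ((1 / (real N * 2 ^ n)) * t)"
    by (simp add: AE_all_countable)
  then have lim: "AE t in lborel. (\<lambda>n. g (t / real 2 ^ n)) \<longlonglongrightarrow> h 0"
  proof eventually_elim
    case (elim t)
    define u where "u n = (1 / (real N * 2 ^ n)) * t" for n :: nat
    have u: "u n = (t / real N) / real 2 ^ n" "real N * u n = t / real 2 ^ n"
        "(1 / real N) * (t / real 2 ^ n) = u n" for n
      using N by (simp_all add: u_def)
    have refine: "?r * H (real N * u n) = M (u n) * H (u n)" for n
      using elim unfolding u_def by blast
    have hu: "(\<lambda>n. h (u n)) \<longlonglongrightarrow> h 0" and Hu: "(\<lambda>n. H (u n)) \<longlonglongrightarrow> H 0"
      and HNu: "(\<lambda>n. H (real N * u n)) \<longlonglongrightarrow> H 0"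
      unfolding u(2) unfolding u(1) by (intro tendsto_divide_power h H; simp)+
    \<comment> \<open>Since H is continuous and nonzero at 0, the scale-N equation can eventually be
      solved for M along the orbit; M itself has no continuity to appeal to.\<close>
    have "eventually (\<lambda>n. H (u n) \<noteq> 0) sequentially"
      by (rule tendsto_imp_eventually_ne[OF Hu h0(2)])
    then have ev: "eventually (\<lambda>n. H (real N * u n) / H (u n) * h (u n) = g (t / real 2 ^ n)) sequentially"
    proof eventually_elim
      case (elim n)
      have "M (u n) = ?r * H (real N * u n) / H (u n)"
        using refine[of n] elim by (simp add: field_simps)
      then show ?case
        using r unfolding g_def u(3) by simp
    qed
    have "(\<lambda>n. H (real N * u n) / H (u n) * h (u n)) \<longlonglongrightarrow> H 0 / H 0 * h 0"
      by (intro tendsto_intros HNu Hu hu h0(2))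
    then show ?case
      using h0(2) ev by (simp add: tendsto_cong)
  qed
  have "AE t in lborel. g t = complex_of_real (sqrt (2 * pi)) * h 0 * h t"
    by (rule refinement_solution_unique[OF h(3) _ g lim]) simp
  then have "AE t in lborel. g t = h t"
    using h(2) by simp
  from AE_scale[OF this, of "real N"]
  have "AE t in lborel. ?r * h (real N * t) = M t * h t"
    using N by (auto simp: g_def field_simps)
  \<comment> \<open>The second use of uniqueness, now at scale N with the product formula of H; the
    resulting constant is again sqrt(2 pi) h(0) = 1.\<close>
  then have "AE t in lborel. h t = complex_of_real (sqrt (2 * pi)) * h 0 * H t"
    using tendsto_divide_power[OF h(1) N] by (intro refinement_solution_unique[OF H(3) N]) auto
  then show ?thesis
    using h(2) by simp
qed

text \<open>Expanding h(2 N t) through scale 2 first or scale N first gives two multiples of h(t),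
  whose factors are the two sides of the claim. Hence h vanishes almost everywhere on the set E
  where they differ.\<close>

lemma commutation_of_fourier_eq:
  fixes h m M :: "real \<Rightarrow> complex"
  assumes N: "N \<ge> 2"
    and f: "f \<in> L2 lborel" "is_L2_fourier f h"
    and orth: "\<And>k l. L2_inner (translate k f) (translate l f) = (if k = l then 1 else 0)"
    and m: "m \<in> L2_circle" "AE t in lborel. complex_of_real (sqrt (real 2)) * h (real 2 * t) = m t * h t"
    and M: "M \<in> L2_circle" "AE t in lborel. complex_of_real (sqrt (real N)) * h (real N * t) = M t * h t"
  shows "AE t in lborel. m (real N * t) * M t = m t * M (2 * t)"
proof -
  have [measurable]: "m \<in> borel_measurable borel" "M \<in> borel_measurable borel"
    using m(1) M(1) by (auto simp: L2_circle_def)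
  have per: "m (t + of_int k * (2 * pi)) = m t" "M (t + of_int k * (2 * pi)) = M t" for t k
    using m(1) M(1) by (auto intro!: periodic_int simp: L2_circle_def)
  define E where "E = {t. m (real N * t) * M t \<noteq> m t * M (2 * t)}"
  have "AE t in lborel. t \<notin> E"
  proof (rule fourier_zero_periodic_null[OF f orth])
    show "E \<in> sets borel"
      unfolding E_def by measurable
    \<comment> \<open>Dilation by an integer preserves the period: the shift becomes N or 2 full
      periods.\<close>
    have "m (real N * (t + 2 * pi)) = m (real N * t)" "M (2 * (t + 2 * pi)) = M (2 * t)"
        "m (t + 2 * pi) = m t" "M (t + 2 * pi) = M t" for t
      using per(1)[of "real N * t" "int N"] per(2)[of "2 * t" 2] per(1)[of t 1] per(2)[of t 1]
      by (simp_all add: distrib_left)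
    then show "t + 2 * pi \<in> E \<longleftrightarrow> t \<in> E" for t
      by (simp add: E_def)
    have "real N \<noteq> 0" using N by simp
    from m(2) M(2) AE_scale[OF m(2) this] AE_scale[OF M(2), of 2, simplified]
    show "AE t in lborel. t \<in> E \<longrightarrow> h t = 0"
    proof eventually_elim
      case (elim t)
      have "(m (real N * t) * M t) * h t = m (real N * t) * (complex_of_real (sqrt (real N)) * h (real N * t))"
        using elim(2) by (simp add: mult.assoc)
      also have "\<dots> = complex_of_real (sqrt (real N)) * (complex_of_real (sqrt 2) * h (2 * (real N * t)))"
        using elim(3) by (simp add: mult_ac)
      also have "\<dots> = complex_of_real (sqrt 2) * (M (2 * t) * h (2 * t))"
        using elim(4) by (simp add: mult_ac)
      also have "\<dots> = (m t * M (2 * t)) * h t"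
        using elim(1) by (simp add: mult_ac)
      finally show ?case by (auto simp: E_def)
    qed
  qed
  then show ?thesis by (simp add: E_def)
qed

theorem proposition11p1:
  fixes N :: nat
    and \<Phi> \<phi> \<Phi>hat \<phi>hat M\<^sub>0 m\<^sub>0 :: "real \<Rightarrow> complex"
  assumes "N \<ge> 2"
    and "father_function N \<Phi>" and "associated_function N \<Phi> M\<^sub>0"
    and "father_function 2 \<phi>" and "associated_function 2 \<phi> m\<^sub>0"
    and "is_L2_fourier \<Phi> \<Phi>hat" and "is_L2_fourier \<phi> \<phi>hat"
    and "isCont \<Phi>hat 0" and "isCont \<phi>hat 0"
    and "product_formula N M\<^sub>0 \<Phi>hat" and "product_formula 2 m\<^sub>0 \<phi>hat"
  shows "((AE x in lborel. \<phi> x = \<Phi> x) \<longleftrightarrow>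
          (AE t in lborel. m\<^sub>0 (real N * t) * M\<^sub>0 t = m\<^sub>0 t * M\<^sub>0 (2 * t))) \<and>
         ((AE t in lborel. m\<^sub>0 (real N * t) * M\<^sub>0 t = m\<^sub>0 t * M\<^sub>0 (2 * t)) \<longleftrightarrow>
          (\<forall>\<xi> \<in> L2_circle. AE t in lborel.
             filter_op 2 m\<^sub>0 (filter_op N M\<^sub>0 \<xi>) t = filter_op N M\<^sub>0 (filter_op 2 m\<^sub>0 \<xi>) t))"
proof (intro conjI iffI)
  note L2 = father_function_L2[OF assms(4)] father_function_L2[OF assms(2)]
  have circle: "m\<^sub>0 \<in> L2_circle" "M\<^sub>0 \<in> L2_circle"
    using assms(3,5) by (auto simp: associated_function_def)
  {
    assume "AE x in lborel. \<phi> x = \<Phi> x"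
    then have eq: "AE t in lborel. \<phi>hat t = \<Phi>hat t"
      using is_L2_fourier_unique[OF L2 _ assms(7,6)] by blast
    \<comment> \<open>To transfer the scale-N equation, the transforms must agree at N t as well as
      at t.\<close>
    have "AE t in lborel. \<phi>hat (real N * t) = \<Phi>hat (real N * t)"
      using AE_scale[OF eq, of "real N"] assms(1) by simp
    with eq product_formula_refinement[OF assms(10,1)]
    have "AE t in lborel. complex_of_real (sqrt (real N)) * \<phi>hat (real N * t) = M\<^sub>0 t * \<phi>hat t"
      by eventually_elim simp
    with product_formula_refinement[OF assms(11)]
    show "AE t in lborel. m\<^sub>0 (real N * t) * M\<^sub>0 t = m\<^sub>0 t * M\<^sub>0 (2 * t)"
      by (intro commutation_of_fourier_eq[OF assms(1) L2(1) assms(7) father_function_orthonormal[OF assms(4)]] circle)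
        auto
  }
  {
    assume "AE t in lborel. m\<^sub>0 (real N * t) * M\<^sub>0 t = m\<^sub>0 t * M\<^sub>0 (2 * t)"
    then have "AE t in lborel. \<phi>hat t = \<Phi>hat t"
      by (rule fourier_eq_of_commutation[OF assms(1) _ assms(9)
            father_function_fourier_at_0[OF assms(4,7,9,11) order_refl] assms(11)
            assms(8) father_function_fourier_at_0[OF assms(2,6,8,10,1)] assms(10)])
    then show "AE x in lborel. \<phi> x = \<Phi> x"
      by (rule is_L2_fourier_inj[OF L2 assms(7,6)])
  }
qed (use commutation_iff in blast)+

end
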